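(* Let $M$ be a $2$-neighborly combinatorial $3$-manifold with vertex set $V$, $n:=|V|$, let $V=V_1\dot\cup V_2$ be a partition with $|V_1|+c=|V_2|-c$ for some $c\in\frac12\mathbb{N}_0$, and let $S=S_{(V_1,V_2)}$ be the associated slicing, with $q$ quadrilaterals and genus $g$ (defined by $\chi(S)=2-2g$). Then \[ q\ \ge\ 4g+\frac{3n}{2}-(4+2c^2). \] Moreover, for $c=0$ this inequality is sharp for all values $g=\binom{n/2-1}{2}$: for every integer $k\ge 3$ there exist a $2$-neighborly combinatorial $3$-manifold $M$ with $n=2k$ vertices and a partition $V=V_1\dot\cup V_2$ with $|V_1|=|V_2|=k$ whose slicing has genus $g=\binom{k-1}{2}$ and exactly $q=4g+3k-4$ quadrilaterals.
   Context: A combinatorial $3$-manifold is a finite pure $3$-dimensional simplicial complex in which the link of every vertex is a combinatorial $2$-sphere; it is $2$-neighborly if every pair of vertices spans an edge. A function $f:M\to\mathbb{R}$ is regular simplexwise linear (rsl) if it is linear on every simplex and takes pairwise distinct values on the vertices. Given a partition $V=V_1\dot\cup V_2$ of the vertex set into nonempty sets, choose an rsl-function $f$ with $f(v)<f(w)$ for all $v\in V_1$, $w\in V_2$ and $x_0$ strictly between $\max f(V_1)$ and $\min f(V_2)$; the slicing $S_{(V_1,V_2)}$ is the polyhedral surface $f^{-1}(x_0)$, whose facets are the triangles and quadrilaterals obtained by intersecting $f^{-1}(x_0)$ with the tetrahedra of $M$ meeting both $V_1$ and $V_2$ (a quadrilateral arises from a tetrahedron with exactly two vertices in each part). *)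

theory Defs
  imports "HOL-Analysis.Analysis"
begin

text \<open>A finite pure simplicial complex is represented by its set of facets
(maximal faces), each facet being a finite set of vertices.  The faces are all
nonempty subsets of facets.\<close>

definition vertices :: "'v set set \<Rightarrow> 'v set" where
  "vertices K = \<Union>K"

definition faces :: "'v set set \<Rightarrow> 'v set set" where
  "faces K = {s. s \<noteq> {} \<and> (\<exists>t\<in>K. s \<subseteq> t)}"

text \<open>Geometric realisation: barycentric coordinate functions supported on a
facet, inside the product space 'v => real (product topology).\<close>

definition realization :: "'v set set \<Rightarrow> ('v \<Rightarrow> real) set" where
  "realization K = {f. \<exists>t\<in>K. (\<forall>x. x \<notin> t \<longrightarrow> f x = 0) \<and> (\<forall>x. 0 \<le> f x) \<and> sum f t = 1}"

text \<open>Combinatorial 2-sphere: a finite pure 2-dimensional simplicial complex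
(facets are triangles) whose realisation is homeomorphic to the 2-sphere
(in dimension 2 every triangulated sphere is a PL / combinatorial sphere).\<close>

definition comb_2_sphere :: "'v set set \<Rightarrow> bool" where
  "comb_2_sphere L \<longleftrightarrow> finite L \<and> L \<noteq> {} \<and> (\<forall>t\<in>L. card t = 3)
     \<and> realization L homeomorphic sphere (0 :: real^3) 1"

definition vlink :: "'v set set \<Rightarrow> 'v \<Rightarrow> 'v set set" where
  "vlink K v = {t - {v} | t. t \<in> K \<and> v \<in> t}"

definition comb_3_manifold :: "'v set set \<Rightarrow> bool" where
  "comb_3_manifold K \<longleftrightarrow> finite K \<and> K \<noteq> {} \<and> (\<forall>t\<in>K. finite t \<and> card t = 4)
     \<and> (\<forall>v\<in>vertices K. comb_2_sphere (vlink K v))"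

definition two_neighborly :: "'v set set \<Rightarrow> bool" where
  "two_neighborly K \<longleftrightarrow> (\<forall>v\<in>vertices K. \<forall>w\<in>vertices K. v \<noteq> w \<longrightarrow> {v, w} \<in> faces K)"

definition is_partition :: "'v set set \<Rightarrow> 'v set \<Rightarrow> 'v set \<Rightarrow> bool" where
  "is_partition K V1 V2 \<longleftrightarrow> V1 \<union> V2 = vertices K \<and> V1 \<inter> V2 = {} \<and> V1 \<noteq> {} \<and> V2 \<noteq> {}"

definition bichromatic :: "'v set set \<Rightarrow> 'v set \<Rightarrow> 'v set \<Rightarrow> nat \<Rightarrow> 'v set set" where
  "bichromatic K V1 V2 d = {s \<in> faces K. card s = d \<and> s \<inter> V1 \<noteq> {} \<and> s \<inter> V2 \<noteq> {}}"

text \<open>The slicing S_(V1,V2): its vertices correspond to bichromatic edges, its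
edges to bichromatic triangles, its facets (triangles / quadrilaterals) to
bichromatic tetrahedra of M.\<close>

definition slicing_euler_char :: "'v set set \<Rightarrow> 'v set \<Rightarrow> 'v set \<Rightarrow> int" where
  "slicing_euler_char K V1 V2 =
     int (card (bichromatic K V1 V2 2)) - int (card (bichromatic K V1 V2 3))
     + int (card (bichromatic K V1 V2 4))"

definition slicing_genus :: "'v set set \<Rightarrow> 'v set \<Rightarrow> 'v set \<Rightarrow> real" where
  "slicing_genus K V1 V2 = (2 - real_of_int (slicing_euler_char K V1 V2)) / 2"

definition slicing_quads :: "'v set set \<Rightarrow> 'v set \<Rightarrow> 'v set \<Rightarrow> nat" where
  "slicing_quads K V1 V2 = card {t \<in> K. card (t \<inter> V1) = 2 \<and> card (t \<inter> V2) = 2}"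

end

theory Submission
  imports Defs
begin

text \<open>
  Counting incidences between bichromatic triangles and tetrahedra shows that \<open>q + 2 \<chi>(S)\<close> equals
  \<open>2 |V1| |V2|\<close> minus the number of bichromatic tetrahedra, so the inequality says that there are
  at most \<open>n (n - 3) / 2\<close> of these. Summing over all vertex links, this follows once a triangulated
  2-sphere with \<open>m\<close> vertices is known to have at most \<open>2 m - 4\<close> triangles.

  For the latter, invariance of domain shows that every edge of the sphere lies in exactly two
  triangles. The sphere minus its vertices is connected, so some \<open>F - 1\<close> edges suffice to link all
  \<open>F\<close> triangles across edges; by the Jordan curve theorem the remaining edges contain no cycle,
  hence number at most \<open>m - 1\<close>.

  Equality holds for the boundary of the cyclic 4-polytope with \<open>2 k\<close> vertices, sliced between even
  and odd vertices: every facet is a union of two edges of the \<open>2 k\<close>-cycle and so becomes a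
  quadrilateral. Its vertex links are stacked spheres, i.e. iterated stellar subdivisions of the
  boundary of a tetrahedron.
\<close>

text \<open>A combinatorial sphere is given by a homeomorphism alone, so every count in a vertex
  link has to be extracted from plane topology. Of Euler's relation, the half V - E + F >= 2 is
  enough. The surface S is never built. Its vertices, edges and facets are the bichromatic edges,
  triangles and tetrahedra of M; that S is closed appears as the fact that a triangle of M lies in
  two tetrahedra, which is the statement on edges of the link of one of its vertices. The constants
  arise as follows. With |V1| = n/2 - c and |V2| = n/2 + c, 2-neighborliness contributes 2 |V1| |V2|
  = n^2/2 - 2 c^2; subtracting n (n - 3)/2 leaves 3n/2 - 2 c^2, and 2 chi = 4 - 4 g supplies the
  rest. Equality therefore forces n (n - 3)/2 tetrahedra, all of them bichromatic. Hence the example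
  needs links with the largest possible number of triangles and a partition for which no facet lies
  within one class.\<close>

section \<open>Loops and finite sets on topological spheres\<close>

text \<open>Puncturing at a point \<open>p\<close> off the loop moves the loop into the plane, where
  Jordan's theorem applies. The inside is bounded, so together with the loop it has a compact image,
  which stays closed on the whole sphere; the inside alone has an open image. The puncture
  \<open>p\<close> shows that the other side is nonempty.\<close>

lemma sphere_minus_simple_loop_not_connected:
  fixes c :: "real \<Rightarrow> real^3"
  assumes c: "simple_path c" "pathfinish c = pathstart c" "path_image c \<subseteq> sphere 0 1"
    and p: "p \<in> sphere 0 1 - path_image c"
  shows "\<not> connected (sphere 0 1 - path_image c)"
proof -
  let ?S = "sphere (0::real^3) 1"
  have "?S - {p} homeomorphic (UNIV::complex set)"
    by (rule homeomorphic_punctured_sphere_affine) (use p in auto)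
  then obtain H G where HG: "homeomorphism (?S - {p}) (UNIV::complex set) H G"
    unfolding homeomorphic_def by blast
  have csub: "path_image c \<subseteq> ?S - {p}" using c p by auto
  have GH: "\<And>x. x \<in> ?S - {p} \<Longrightarrow> G (H x) = x" and HG1: "\<And>z. H (G z) = z"
    and Gim: "range G = ?S - {p}" and contG: "continuous_on UNIV G"
    using HG by (auto simp: homeomorphism_def)
  have injH: "inj_on H (?S - {p})" by (rule inj_on_inverseI[of _ G]) (rule GH)
  have contH: "continuous_on (?S - {p}) H" using HG by (simp add: homeomorphism_def)
  define d where "d = H \<circ> c"
  have d: "simple_path d" "pathfinish d = pathstart d"
    unfolding d_def using c simple_path_continuous_image[OF c(1) continuous_on_subset[OF contH csub]
      inj_on_subset[OF injH csub]] by (simp_all add: pathfinish_compose pathstart_compose)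
  have imd: "path_image d = H ` path_image c" by (simp add: d_def path_image_compose)
  have Gd: "G ` path_image d = path_image c"
  proof -
    have "(\<lambda>x. G (H x)) ` path_image c = (\<lambda>x. x) ` path_image c"
      by (rule image_cong) (use GH csub in blast)+
    then show ?thesis unfolding imd image_image by simp
  qed
  have J: "inside (path_image d) \<noteq> {}" "open (inside (path_image d))" "bounded (inside (path_image d))"
    using Jordan_inside_outside[OF d] by auto
  define T where "T = path_image d \<union> inside (path_image d)"
  have "closed T" unfolding T_def using closed_path_image_Un_inside[of d] d by (simp add: simple_path_imp_path)
  moreover have "bounded T" unfolding T_def using J(3) bounded_path_image[OF simple_path_imp_path[OF d(1)]] by simp
  ultimately have "compact T" by (simp add: compact_eq_bounded_closed)
  then have clT: "closed (G ` T)"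
    by (meson compact_continuous_image compact_imp_closed contG continuous_on_subset subset_UNIV)
  define A where "A = G ` inside (path_image d)"
  have "openin (top_of_set (?S - {p})) A"
    unfolding A_def by (rule homeomorphism_imp_open_map[OF homeomorphism_symD[OF HG]]) (use J(2) in simp)
  moreover have "openin (top_of_set ?S) (?S - {p})"
    by (simp add: openin_delete)
  ultimately have "openin (top_of_set ?S) A" by (rule openin_trans)
  then have "closedin (top_of_set ?S) (?S - A)" by (simp add: closedin_diff)
  then have clB: "closed (?S - A)" by (rule closedin_closed_trans) simp
  have AT: "A \<subseteq> G ` T" unfolding A_def T_def by auto
  have int: "G ` T \<inter> (?S - A) \<subseteq> path_image c"
    unfolding T_def A_def using Gd by auto
  have Ac: "A \<inter> path_image c = {}"
  proof -
    have "inj G" using HG1 by (metis injI)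
    then show ?thesis unfolding A_def Gd[symmetric] by (simp add: image_Int[symmetric])
  qed
  have AS: "A \<subseteq> ?S - {p}" using Gim unfolding A_def by auto
  have "A \<noteq> {}" using J unfolding A_def by auto
  have "?S - path_image c \<subseteq> G ` T \<union> (?S - A)" using AT by blast
  moreover have "G ` T \<inter> (?S - A) \<inter> (?S - path_image c) = {}" using int by blast
  moreover have "G ` T \<inter> (?S - path_image c) \<noteq> {}" using AT Ac AS \<open>A \<noteq> {}\<close> by blast
  moreover have "(?S - A) \<inter> (?S - path_image c) \<noteq> {}" using AS p by blast
  ultimately show ?thesis using clT clB unfolding connected_closed by blast
qed

text \<open>Realizations live in a function space, hence the transport to an arbitrary topological
  space. The inclusion is proper so that a point is left at which to puncture the sphere.\<close>

lemma homeomorphic_sphere_minus_simple_loop_not_connected: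
  fixes X :: "'a::topological_space set"
  assumes X: "X homeomorphic sphere (0::real^3) 1"
    and c: "simple_path c" "pathfinish c = pathstart c" "path_image c \<subset> X"
  shows "\<not> connected (X - path_image c)"
proof -
  let ?S = "sphere (0::real^3) 1"
  obtain h k where hk: "homeomorphism X ?S h k" using X unfolding homeomorphic_def by blast
  have kh: "\<And>x. x \<in> X \<Longrightarrow> k (h x) = x" and him: "h ` X = ?S" and conth: "continuous_on X h"
    using hk by (auto simp: homeomorphism_def)
  have injh: "inj_on h X" by (rule inj_on_inverseI[of _ k]) (rule kh)
  have im: "path_image (h \<circ> c) = h ` path_image c" by (simp add: path_image_compose)
  have hdiff: "h ` (X - path_image c) = ?S - path_image (h \<circ> c)"
    unfolding im using inj_on_image_set_diff[OF injh, of X "path_image c"] him c by auto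
  obtain x where "x \<in> X - path_image c" using c by blast
  then have "h x \<in> ?S - path_image (h \<circ> c)" using hdiff by blast
  moreover have "simple_path (h \<circ> c)"
    using simple_path_continuous_image[OF c(1) continuous_on_subset[OF conth] inj_on_subset[OF injh]] c
    by blast
  moreover have "pathfinish (h \<circ> c) = pathstart (h \<circ> c)" using c by (simp add: pathfinish_compose pathstart_compose)
  moreover have "path_image (h \<circ> c) \<subseteq> ?S" unfolding im using c him by blast
  ultimately have "\<not> connected (?S - path_image (h \<circ> c))"
    using sphere_minus_simple_loop_not_connected by blast
  moreover have "X - path_image c homeomorphic ?S - path_image (h \<circ> c)"
    unfolding homeomorphic_def using homeomorphism_of_subsets[OF hk _ _ hdiff] by auto
  ultimately show ?thesis by (simp add: homeomorphic_connectedness)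
qed

text \<open>One puncture turns the space into a single planar chart, the setting in which invariance
  of domain is applied below.\<close>

lemma homeomorphic_sphere_punctured:
  fixes X :: "'a::topological_space set"
  assumes X: "X homeomorphic sphere (0::real^3) 1" and p: "p \<in> X"
  shows "X - {p} homeomorphic (UNIV::complex set)"
proof -
  let ?S = "sphere (0::real^3) 1"
  obtain h k where hk: "homeomorphism X ?S h k" using X unfolding homeomorphic_def by blast
  have kh: "\<And>x. x \<in> X \<Longrightarrow> k (h x) = x" and him: "h ` X = ?S"
    using hk by (auto simp: homeomorphism_def)
  have injh: "inj_on h X" by (rule inj_on_inverseI[of _ k]) (rule kh)
  have hp: "h ` (X - {p}) = ?S - {h p}"
    using inj_on_image_set_diff[OF injh, of X "{p}"] him p by auto
  have "X - {p} homeomorphic ?S - {h p}"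
    unfolding homeomorphic_def using homeomorphism_of_subsets[OF hk _ _ hp] by auto
  moreover have "?S - {h p} homeomorphic (UNIV::complex set)"
    by (rule homeomorphic_punctured_sphere_affine) (use him p in auto)
  ultimately show ?thesis using homeomorphic_trans by blast
qed

text \<open>The puncture is taken at a removed point \<open>p\<close>; the remaining removed points
  form a countable subset of the plane, whose complement is path connected.\<close>

lemma homeomorphic_sphere_minus_finite_connected:
  fixes X :: "'a::topological_space set"
  assumes X: "X homeomorphic sphere (0::real^3) 1" and W: "finite W" "p \<in> W" "W \<subseteq> X"
  shows "connected (X - W)"
proof -
  have "X - {p} homeomorphic (UNIV::complex set)"
    by (rule homeomorphic_sphere_punctured) (use assms in auto)
  then obtain H G where HG: "homeomorphism (X - {p}) (UNIV::complex set) H G"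
    unfolding homeomorphic_def by blast
  have GH: "\<And>x. x \<in> X - {p} \<Longrightarrow> G (H x) = x" and HG1: "\<And>z. H (G z) = z"
    and Gim: "range G = X - {p}" and contG: "continuous_on UNIV G"
    using HG by (auto simp: homeomorphism_def)
  have "connected (- (H ` (W - {p})))"
    by (intro path_connected_imp_connected path_connected_complement_countable)
       (use W in \<open>auto intro: countable_finite\<close>)
  then have "connected (G ` (- (H ` (W - {p}))))"
    using connected_continuous_image continuous_on_subset[OF contG] by blast
  moreover have "G ` (- (H ` (W - {p}))) = X - W"
  proof (intro equalityI subsetI)
    fix x assume "x \<in> G ` (- (H ` (W - {p})))"
    then obtain z where z: "x = G z" "z \<notin> H ` (W - {p})" by blast
    then have "x \<in> X - {p}" using Gim by auto
    moreover have "x \<notin> W - {p}" using z HG1 by (metis image_eqI)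
    ultimately show "x \<in> X - W" by blast
  next
    fix x assume x: "x \<in> X - W"
    then have "x = G (H x)" using GH W by (metis Diff_iff singletonD)
    moreover have "H x \<notin> H ` (W - {p})"
    proof
      assume "H x \<in> H ` (W - {p})"
      then obtain w where "w \<in> W - {p}" "H x = H w" by blast
      then have "x = w" using GH x W by (metis Diff_iff singletonD subsetD)
      then show False using x \<open>w \<in> W - {p}\<close> by blast
    qed
    ultimately show "x \<in> G ` (- (H ` (W - {p})))" by blast
  qed
  ultimately show ?thesis by simp
qed

section \<open>Triangulated 2-spheres\<close>

lemma mem_realization_single:
  "f \<in> realization {s} \<longleftrightarrow> (\<forall>x. x \<notin> s \<longrightarrow> f x = 0) \<and> (\<forall>x. 0 \<le> f x) \<and> sum f s = 1"
  by (simp add: realization_def)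

lemma realization_eq_UN: "realization L = (\<Union>t\<in>L. realization {t})"
  by (auto simp: realization_def)

lemma realization_singleI:
  assumes "finite t" "\<And>x. x \<notin> t \<Longrightarrow> f x = 0" "\<And>x. 0 \<le> f x" "sum f t = 1"
  shows "f \<in> realization {t}"
  using assms by (simp add: mem_realization_single)

definition mix :: "real \<Rightarrow> ('v \<Rightarrow> real) \<Rightarrow> ('v \<Rightarrow> real) \<Rightarrow> 'v \<Rightarrow> real" where
  "mix u f g = (\<lambda>x. (1 - u) * f x + u * g x)"

text \<open>For a singleton this is the vertex itself; for an edge or a triangle it is the witness
  for a relative interior point.\<close>

definition centroid :: "'v set \<Rightarrow> 'v \<Rightarrow> real" where
  "centroid s = (\<lambda>x. if x \<in> s then 1 / real (card s) else 0)"

abbreviation pt :: "'v \<Rightarrow> 'v \<Rightarrow> real" where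
  "pt a \<equiv> centroid {a}"

lemma pt_apply: "pt a x = (if x = a then 1 else 0)"
  by (simp add: centroid_def)

lemma mix_0 [simp]: "mix 0 f g = f" and mix_1 [simp]: "mix 1 f g = g"
  by (auto simp: mix_def)

lemma mix_in_realization_single:
  assumes "f \<in> realization {s}" "g \<in> realization {s}" "0 \<le> u" "u \<le> 1"
  shows "mix u f g \<in> realization {s}"
  using assms by (simp add: mem_realization_single mix_def sum.distrib sum_distrib_left[symmetric])

lemma continuous_on_mix: "continuous_on S (\<lambda>u. mix u f g)"
  unfolding mix_def by (intro continuous_on_coordinatewise_then_product continuous_intros)

lemma centroid_in_realization_single:
  assumes "finite t" "s \<subseteq> t" "s \<noteq> {}"
  shows "centroid s \<in> realization {t}"
proof -
  have "finite s" using assms finite_subset by blast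
  then have "sum (centroid s) t = 1"
    using assms sum.inter_restrict[OF \<open>finite t\<close>, of "\<lambda>x. 1 / real (card s)" s]
    by (simp add: centroid_def Int_absorb1)
  then show ?thesis using assms by (auto simp: mem_realization_single centroid_def)
qed

lemma centroid_in_realization_single_iff:
  assumes "centroid s \<in> realization {t}" "finite s"
  shows "s \<subseteq> t"
proof
  fix x assume "x \<in> s"
  then have "card s \<noteq> 0" using assms by auto
  then show "x \<in> t" using assms \<open>x \<in> s\<close> by (auto simp: mem_realization_single centroid_def)
qed

lemma realization_single_pair:
  assumes "f \<in> realization {{a, b}}" "f a = 0"
  shows "f = pt b"
proof -
  have "f b = 1" "\<And>x. x \<notin> {a,b} \<Longrightarrow> f x = 0" using assms
    by (auto simp: mem_realization_single) (cases "a = b"; simp)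
  then have "f x = pt b x" for x using assms(2) by (cases "x = a"; cases "x = b") (auto simp: pt_apply)
  then show ?thesis by blast
qed

lemma connected_star_mix:
  assumes "z \<in> S" "\<And>f u. f \<in> S \<Longrightarrow> 0 \<le> u \<Longrightarrow> u \<le> 1 \<Longrightarrow> mix u z f \<in> S"
  shows "connected S"
proof -
  have "connected (\<Union>f\<in>S. (\<lambda>u. mix u z f) ` {0..1})"
  proof (rule connected_Union)
    fix T assume "T \<in> (\<lambda>f. (\<lambda>u. mix u z f) ` {0..1}) ` S"
    then show "connected T" by (auto intro!: connected_continuous_image continuous_on_mix)
  next
    have "z \<in> (\<lambda>u. mix u z f) ` {0..1}" for f
      by (rule image_eqI[of _ _ 0]) auto
    then show "\<Inter> ((\<lambda>f. (\<lambda>u. mix u z f) ` {0..1}) ` S) \<noteq> {}" by blast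
  qed
  moreover have "(\<Union>f\<in>S. (\<lambda>u. mix u z f) ` {0..1}) = S"
  proof
    show "S \<subseteq> (\<Union>f\<in>S. (\<lambda>u. mix u z f) ` {0..1})"
    proof
      fix f assume "f \<in> S"
      moreover have "f \<in> (\<lambda>u. mix u z f) ` {0..1}" by (rule image_eqI[of _ _ 1]) auto
      ultimately show "f \<in> (\<Union>f\<in>S. (\<lambda>u. mix u z f) ` {0..1})" by blast
    qed
  qed (use assms in auto)
  ultimately show ?thesis by simp
qed

text \<open>A separation puts each connected piece on one side. The pieces on one side form a proper
  nonempty subfamily, and a point that it shares with a piece outside would lie on both
  sides.\<close>

lemma connected_UN_linked:
  assumes con: "\<And>i. i \<in> I \<Longrightarrow> connected (S i)"
    and link: "\<And>A. A \<subseteq> I \<Longrightarrow> A \<noteq> {} \<Longrightarrow> A \<noteq> I \<Longrightarrow> \<exists>i\<in>A. \<exists>j\<in>I - A. S i \<inter> S j \<noteq> {}"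
  shows "connected (\<Union>i\<in>I. S i)"
proof (rule connectedI)
  fix U V assume UV: "open U" "open V" "U \<inter> (\<Union>i\<in>I. S i) \<noteq> {}" "V \<inter> (\<Union>i\<in>I. S i) \<noteq> {}"
    "U \<inter> V \<inter> (\<Union>i\<in>I. S i) = {}" "(\<Union>i\<in>I. S i) \<subseteq> U \<union> V"
  define A where "A = {i\<in>I. S i \<inter> U \<noteq> {}}"
  have sep: "S i \<inter> U = {} \<or> S i \<inter> V = {}" if "i \<in> I" for i
  proof -
    have "U \<inter> V \<inter> S i = {}" "S i \<subseteq> U \<union> V" using UV that by auto
    then show ?thesis using connectedD[OF con[OF that] UV(1,2)] by blast
  qed
  have "A \<noteq> {}" using UV unfolding A_def by auto
  moreover have "A \<noteq> I" using UV sep unfolding A_def by blast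
  ultimately obtain i j x where ij: "i \<in> A" "j \<in> I - A" "x \<in> S i" "x \<in> S j"
    using link[of A] unfolding A_def by blast
  then have "x \<notin> U" unfolding A_def by blast
  then have "x \<in> V" using ij UV by blast
  then show False using ij sep[of i] unfolding A_def by blast
qed

section \<open>Dual connectivity of triangles and loops in the edge graph\<close>

definition edges :: "'v set set \<Rightarrow> 'v set set" where
  "edges L = {e. card e = 2 \<and> (\<exists>t\<in>L. e \<subseteq> t)}"

text \<open>Connectedness of the dual graph, whose nodes are the triangles and whose arcs are shared
  members of \<open>D\<close>. It is phrased by cuts rather than by walks, to match
  \<open>connected_UN_linked\<close>.\<close>

definition linked_by :: "'v set set \<Rightarrow> 'v set set \<Rightarrow> bool" where
  "linked_by D L \<longleftrightarrow> (\<forall>A\<subseteq>L. A \<noteq> {} \<longrightarrow> A \<noteq> L \<longrightarrow> (\<exists>t\<in>A. \<exists>t'\<in>L - A. \<exists>e\<in>D. e \<subseteq> t \<and> e \<subseteq> t'))"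

text \<open>The base vertex \<open>a\<close> is kept apart from the path \<open>vs\<close> that
  returns to it. Length at least 2 rules out running back and forth along a single edge.\<close>

definition cycle_in :: "'v set set \<Rightarrow> 'v \<Rightarrow> 'v list \<Rightarrow> bool" where
  "cycle_in R a vs \<longleftrightarrow> distinct (a # vs) \<and> length vs \<ge> 2 \<and> {a, hd vs} \<in> R \<and> {last vs, a} \<in> R
     \<and> successively (\<lambda>x y. {x, y} \<in> R) vs"

lemma arc_edge:
  assumes "a \<noteq> b"
  shows "arc (\<lambda>u. mix u (pt a) (pt b))"
    "pathstart (\<lambda>u. mix u (pt a) (pt b)) = pt a" "pathfinish (\<lambda>u. mix u (pt a) (pt b)) = pt b"
    "path_image (\<lambda>u. mix u (pt a) (pt b)) \<subseteq> realization {{a, b}}"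
proof -
  show "arc (\<lambda>u. mix u (pt a) (pt b))"
    unfolding arc_def path_def
  proof (intro conjI continuous_on_mix inj_onI)
    fix u v assume "mix u (pt a) (pt b) = mix v (pt a) (pt b)"
    from fun_cong[OF this, of b] show "u = v" using assms by (simp add: mix_def pt_apply)
  qed
  show "path_image (\<lambda>u. mix u (pt a) (pt b)) \<subseteq> realization {{a, b}}"
    unfolding path_image_def
    by (auto intro!: mix_in_realization_single centroid_in_realization_single)
qed (simp_all add: pathstart_def pathfinish_def)

text \<open>Confining the image to edges within \<open>set vs\<close> carries the induction: on the
  arc through the tail the coordinate at the new vertex \<open>a\<close> vanishes, so the new
  segment meets that arc only in their common end.\<close>

lemma arc_along_path:
  assumes "distinct vs" "length vs \<ge> 2" "successively (\<lambda>x y. {x, y} \<in> R) vs"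
  shows "\<exists>g. arc g \<and> pathstart g = pt (hd vs) \<and> pathfinish g = pt (last vs)
    \<and> path_image g \<subseteq> (\<Union>e\<in>{e\<in>R. e \<subseteq> set vs}. realization {e})"
  using assms
proof (induction vs)
  case (Cons a vs)
  then obtain b ws where vs: "vs = b # ws" by (cases vs) auto
  have ab: "a \<noteq> b" "{a, b} \<in> R" using Cons.prems vs by auto
  let ?g = "\<lambda>u. mix u (pt a) (pt b)"
  show ?case
  proof (cases ws)
    case Nil
    have "path_image ?g \<subseteq> (\<Union>e\<in>{e\<in>R. e \<subseteq> set (a # vs)}. realization {e})"
      using arc_edge(4)[OF ab(1)] ab vs by auto
    then show ?thesis using arc_edge[OF ab(1)] vs Nil by (intro exI[of _ ?g]) auto
  next
    case (Cons c cs)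
    then have "length vs \<ge> 2" using vs by simp
    moreover have "distinct vs" "successively (\<lambda>x y. {x, y} \<in> R) vs"
      using Cons.prems vs by auto
    ultimately obtain g where g: "arc g" "pathstart g = pt b" "pathfinish g = pt (last vs)"
      "path_image g \<subseteq> (\<Union>e\<in>{e\<in>R. e \<subseteq> set vs}. realization {e})"
      using Cons.IH vs by auto
    have "f = pt b" if f: "f \<in> path_image ?g" "f \<in> path_image g" for f
    proof -
      have "f \<in> realization {{a, b}}" using f arc_edge(4)[OF ab(1)] by blast
      moreover obtain e where "e \<subseteq> set vs" "f \<in> realization {e}" using subsetD[OF g(4) f(2)] by auto
      then have "f a = 0" using Cons.prems(1) by (auto simp: mem_realization_single)
      ultimately show ?thesis by (rule realization_single_pair)
    qed
    then have "arc (?g +++ g)"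
      using arc_edge[OF ab(1)] g by (intro arc_join) auto
    moreover have "path_image (?g +++ g) \<subseteq> (\<Union>e\<in>{e\<in>R. e \<subseteq> set (a # vs)}. realization {e})"
    proof -
      have "path_image ?g \<subseteq> (\<Union>e\<in>{e\<in>R. e \<subseteq> set (a # vs)}. realization {e})"
        using arc_edge(4)[OF ab(1)] ab vs by auto
      moreover have "path_image g \<subseteq> (\<Union>e\<in>{e\<in>R. e \<subseteq> set (a # vs)}. realization {e})"
        by (rule order_trans[OF g(4)]) auto
      ultimately show ?thesis using path_image_join_subset[of ?g g] by blast
    qed
    ultimately show ?thesis using arc_edge[OF ab(1)] g vs by (intro exI[of _ "?g +++ g"]) auto
  qed
qed simp

text \<open>The arc through \<open>vs\<close> is closed by two segments at \<open>a\<close>. The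
  coordinate at \<open>a\<close> is zero on the arc, and the segments have different far ends
  because \<open>vs\<close> has at least two vertices; so the pieces meet only where they are
  joined.\<close>

lemma loop_along_cycle:
  assumes "cycle_in R a vs"
  shows "\<exists>c. simple_path c \<and> pathfinish c = pathstart c \<and> path_image c \<subseteq> (\<Union>e\<in>R. realization {e})"
proof -
  have vs: "distinct vs" "a \<notin> set vs" "length vs \<ge> 2" "{a, hd vs} \<in> R" "{last vs, a} \<in> R"
    "successively (\<lambda>x y. {x, y} \<in> R) vs"
    using assms by (auto simp: cycle_in_def)
  obtain g where g: "arc g" "pathstart g = pt (hd vs)" "pathfinish g = pt (last vs)"
    "path_image g \<subseteq> (\<Union>e\<in>{e\<in>R. e \<subseteq> set vs}. realization {e})"
    using arc_along_path[OF vs(1,3,6)] by blast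
  have g0: "f a = 0" if f: "f \<in> path_image g" for f
  proof -
    obtain e where "e \<subseteq> set vs" "f \<in> realization {e}" using subsetD[OF g(4) f] by auto
    then show ?thesis using vs(2) by (auto simp: mem_realization_single)
  qed
  have "vs \<noteq> []" using vs by auto
  then have ne: "a \<noteq> hd vs" "last vs \<noteq> a" using vs(2) by auto
  have hl: "hd vs \<noteq> last vs"
    using vs(1,3) by (cases vs) auto
  let ?p = "\<lambda>u. mix u (pt (last vs)) (pt a)" and ?q = "\<lambda>u. mix u (pt a) (pt (hd vs))"
  note p = arc_edge[OF ne(2)] and q = arc_edge[OF ne(1)]
  have pq: "path_image ?p \<inter> path_image ?q \<subseteq> {pt a}"
  proof clarify
    fix f assume "f \<in> path_image ?p" "f \<in> path_image ?q"
    then have f: "f \<in> realization {{last vs, a}}" "f \<in> realization {{a, hd vs}}" using p(4) q(4) by blast+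
    then have "f (last vs) = 0" using hl ne by (auto simp: mem_realization_single)
    with f(1) show "f = pt a" by (rule realization_single_pair)
  qed
  have arcpq: "arc (?p +++ ?q)" using p q pq by (intro arc_join) auto
  have im: "path_image (?p +++ ?q) \<subseteq> realization {{last vs, a}} \<union> realization {{a, hd vs}}"
    using p(4) q(4) path_image_join_subset[of ?p ?q] by blast
  have "path_image g \<inter> path_image (?p +++ ?q) \<subseteq> {pathstart g, pathstart (?p +++ ?q)}"
  proof
    fix f assume f: "f \<in> path_image g \<inter> path_image (?p +++ ?q)"
    then have "f \<in> path_image (?p +++ ?q)" by (rule IntD2)
    from subsetD[OF im this] have "f \<in> realization {{a, last vs}} \<or> f \<in> realization {{a, hd vs}}"
      by (simp add: insert_commute)
    moreover have "f a = 0" using g0 f by simp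
    ultimately have "f = pt (last vs) \<or> f = pt (hd vs)"
      using realization_single_pair[of f a "last vs"] realization_single_pair[of f a "hd vs"] by argo
    then show "f \<in> {pathstart g, pathstart (?p +++ ?q)}" using g(2) p(2) by auto
  qed
  then have "simple_path (g +++ (?p +++ ?q))"
    using g p q arcpq by (intro simple_path_join_loop) auto
  moreover have "pathfinish (g +++ (?p +++ ?q)) = pathstart (g +++ (?p +++ ?q))"
    using g q by simp
  moreover have "path_image (g +++ (?p +++ ?q)) \<subseteq> (\<Union>e\<in>R. realization {e})"
  proof -
    have "path_image g \<subseteq> (\<Union>e\<in>R. realization {e})" by (rule order_trans[OF g(4)]) auto
    moreover have "path_image (?p +++ ?q) \<subseteq> (\<Union>e\<in>R. realization {e})"
      by (rule order_trans[OF im]) (use vs(4,5) in auto)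
    ultimately show ?thesis using path_image_join_subset[of g "?p +++ ?q"] by (meson Un_least order_trans)
  qed
  ultimately show ?thesis by (intro exI conjI)
qed

text \<open>If the triangles are linked by crossing the edges of \<open>D\<close>, then the complement of a cycle
avoiding \<open>D\<close> is connected, against the Jordan curve theorem.\<close>

lemma sphere_no_cycle_off_linking_edges:
  fixes L :: "'v set set"
  assumes S: "comb_2_sphere L" and D: "linked_by D L" "\<forall>e\<in>D. card e = 2" and R: "R \<subseteq> edges L" "R \<inter> D = {}"
  shows "\<not> cycle_in R a vs"
proof
  assume "cycle_in R a vs"
  then obtain c where c: "simple_path c" "pathfinish c = pathstart c"
    "path_image c \<subseteq> (\<Union>e\<in>R. realization {e})"
    using loop_along_cycle by metis
  let ?C = "path_image c"
  have L: "L \<noteq> {}" "\<And>t. t \<in> L \<Longrightarrow> card t = 3" "realization L homeomorphic sphere (0 :: real^3) 1"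
    using S by (auto simp: comb_2_sphere_def)
  have fin: "finite t" if "t \<in> L" for t using L(2)[OF that] card.infinite by fastforce
  have R2: "card e = 2" if "e \<in> R" for e using R that by (auto simp: edges_def)
  \<comment> \<open>The loop runs within edges, where at most two coordinates are nonzero, so it
    misses every point with three positive coordinates.\<close>
  have pos: "f \<notin> ?C" if "t \<in> L" "\<And>x. x \<in> t \<Longrightarrow> f x > 0" for f t
  proof
    assume "f \<in> ?C"
    then obtain e where e: "e \<in> R" "f \<in> realization {e}" using subsetD[OF c(3)] by auto
    then have "t \<subseteq> e" using that by (fastforce simp: mem_realization_single)
    moreover have "finite e" using R2[OF e(1)] card.infinite by fastforce
    ultimately have "card t \<le> card e" by (simp add: card_mono)
    then show False using L(2)[OF that(1)] R2[OF e(1)] by simp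
  qed
  have cen: "centroid t \<in> realization {t} - ?C" if "t \<in> L" for t
  proof -
    have "t \<noteq> {}" using L(2)[OF that] by auto
    moreover have "centroid t x > 0" if "x \<in> t" for x
      using that L(2)[OF \<open>t \<in> L\<close>] by (simp add: centroid_def)
    ultimately show ?thesis using pos[OF that] centroid_in_realization_single[OF fin[OF that]] by auto
  qed
  \<comment> \<open>The triangle minus the loop is star-shaped about its centroid: a segment from
    there has all three coordinates positive until it reaches its far end.\<close>
  have con: "connected (realization {t} - ?C)" if "t \<in> L" for t
  proof (rule connected_star_mix[OF cen[OF that]])
    fix f and u :: real assume f: "f \<in> realization {t} - ?C" and u: "0 \<le> u" "u \<le> 1"
    have "mix u (centroid t) f \<in> realization {t}"
      using mix_in_realization_single[of "centroid t" t f u] cen[OF that] f u by blast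
    moreover have "mix u (centroid t) f \<notin> ?C"
    proof (cases "u = 1")
      case True then show ?thesis using f by simp
    next
      case False
      have "mix u (centroid t) f x > 0" if "x \<in> t" for x
      proof -
        have "centroid t x > 0" using that L(2)[OF \<open>t \<in> L\<close>] by (simp add: centroid_def)
        moreover have "f x \<ge> 0" using f by (auto simp: mem_realization_single)
        ultimately show ?thesis unfolding mix_def using u False by (intro add_pos_nonneg) auto
      qed
      then show ?thesis using pos[OF that] by blast
    qed
    ultimately show "mix u (centroid t) f \<in> realization {t} - ?C" by blast
  qed
  have "connected (\<Union>t\<in>L. realization {t} - ?C)"
  proof (rule connected_UN_linked[OF con])
    fix A assume "A \<subseteq> L" "A \<noteq> {}" "A \<noteq> L"
    then obtain t t' e where t: "t \<in> A" "t' \<in> L - A" "e \<in> D" "e \<subseteq> t" "e \<subseteq> t'"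
      using D(1) unfolding linked_by_def by meson
    have e: "card e = 2" "finite e" "e \<noteq> {}" using D(2) t card.infinite by fastforce+
    \<comment> \<open>Two linked triangles share the midpoint of \<open>e\<close>. An edge of
      \<open>R\<close> through this midpoint would have to be \<open>e\<close> itself, but
      \<open>R\<close> avoids \<open>D\<close>.\<close>
    have "centroid e \<notin> ?C"
    proof
      assume "centroid e \<in> ?C"
      then obtain e' where e': "e' \<in> R" "centroid e \<in> realization {e'}" using subsetD[OF c(3)] by auto
      then have "e \<subseteq> e'" using centroid_in_realization_single_iff e by blast
      moreover have "finite e'" using R2[OF e'(1)] card.infinite by fastforce
      ultimately have "e = e'" using R2[OF e'(1)] e by (metis card_subset_eq)
      then show False using e' t R by blast
    qed
    moreover have "centroid e \<in> realization {t}" "centroid e \<in> realization {t'}"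
      using t e fin \<open>A \<subseteq> L\<close> by (auto intro!: centroid_in_realization_single)
    ultimately show "\<exists>i\<in>A. \<exists>j\<in>L - A. (realization {i} - ?C) \<inter> (realization {j} - ?C) \<noteq> {}"
      using t by blast
  qed
  moreover have "(\<Union>t\<in>L. realization {t} - ?C) = realization L - ?C"
    by (subst (2) realization_eq_UN) blast
  moreover have "?C \<subset> realization L"
  proof
    show "?C \<subseteq> realization L"
    proof
      fix f assume "f \<in> ?C"
      then obtain e where e: "e \<in> R" "f \<in> realization {e}" using subsetD[OF c(3)] by auto
      then obtain t where t: "t \<in> L" "e \<subseteq> t" using R by (auto simp: edges_def)
      have "sum f t = sum f e" using e t fin by (intro sum.mono_neutral_right) (auto simp: mem_realization_single)
      then have "f \<in> realization {t}" using e t by (auto simp: mem_realization_single)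
      then show "f \<in> realization L" using t realization_eq_UN by blast
    qed
    obtain t where "t \<in> L" using L by blast
    then have "centroid t \<in> realization L - ?C" using cen realization_eq_UN by blast
    then show "?C \<noteq> realization L" by blast
  qed
  ultimately show False
    using homeomorphic_sphere_minus_simple_loop_not_connected[OF L(3) c(1,2)] by simp
qed

lemma closed_realization:
  assumes "finite L" shows "closed (realization L)"
proof -
  have 1: "continuous_on UNIV (\<lambda>f::'a \<Rightarrow> real. f x)" for x by simp
  have "closed (realization {t})" for t :: "'a set"
  proof -
    have "realization {t} = (\<Inter>x\<in>-t. {f. f x = 0}) \<inter> (\<Inter>x. {f. 0 \<le> f x}) \<inter> {f. sum f t = 1}"
      by (auto simp: mem_realization_single)
    moreover have "closed {f::'a \<Rightarrow> real. sum f t = 1}"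
      by (intro closed_Collect_eq continuous_on_sum 1 continuous_on_const)
    moreover have "closed {f::'a \<Rightarrow> real. f x = 0}" "closed {f::'a \<Rightarrow> real. 0 \<le> f x}" for x
      by (intro closed_Collect_eq closed_Collect_le 1 continuous_on_const)+
    ultimately show ?thesis by (auto intro!: closed_Int closed_INT)
  qed
  then show ?thesis using assms by (subst realization_eq_UN) auto
qed

text \<open>If no edge were shared across the cut, the closed subcomplexes \<open>A\<close> and
  \<open>L - A\<close> could meet only in vertices, and deleting these finitely many points would
  disconnect the sphere.\<close>

lemma sphere_linked_by_edges:
  fixes L :: "'v set set"
  assumes S: "comb_2_sphere L"
  shows "linked_by (edges L) L"
  unfolding linked_by_def
proof (intro allI impI, rule ccontr)
  fix A assume A: "A \<subseteq> L" "A \<noteq> {}" "A \<noteq> L"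
    and no: "\<not> (\<exists>t\<in>A. \<exists>t'\<in>L - A. \<exists>e\<in>edges L. e \<subseteq> t \<and> e \<subseteq> t')"
  have L: "finite L" "L \<noteq> {}" "\<And>t. t \<in> L \<Longrightarrow> card t = 3" "realization L homeomorphic sphere (0 :: real^3) 1"
    using S by (auto simp: comb_2_sphere_def)
  have fin: "finite t" if "t \<in> L" for t using L(3)[OF that] card.infinite by fastforce
  let ?W = "pt ` vertices L"
  have fW: "finite ?W" using L(1) fin by (auto simp: vertices_def)
  have "?W \<noteq> {}" using L by (force simp: vertices_def)
  then obtain p where p: "p \<in> ?W" by blast
  have "?W \<subseteq> realization L"
    using fin by (subst realization_eq_UN) (auto simp: vertices_def intro!: centroid_in_realization_single)
  then have "connected (realization L - ?W)"
    using homeomorphic_sphere_minus_finite_connected[OF L(4) fW p] by blast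
  moreover have "closed (realization A)" "closed (realization (L - A))"
    using closed_realization L(1) A by (meson finite_subset finite_Diff)+
  moreover have "realization L - ?W \<subseteq> realization A \<union> realization (L - A)"
    by (subst (1 2 3) realization_eq_UN) blast
  moreover have "realization A \<inter> realization (L - A) \<inter> (realization L - ?W) = {}"
  proof (rule ccontr)
    assume "realization A \<inter> realization (L - A) \<inter> (realization L - ?W) \<noteq> {}"
    then obtain f where f: "f \<in> realization A" "f \<in> realization (L - A)" "f \<notin> ?W" by blast
    then obtain t t' where t: "t \<in> A" "t' \<in> L - A" "f \<in> realization {t}" "f \<in> realization {t'}"
      by (metis UN_E realization_eq_UN)
    have ft: "finite t" "t \<in> L" using t A fin by auto
    \<comment> \<open>A point of both triangles is supported on their common vertices; without a
      common edge there is just one such vertex, and the point is that vertex.\<close>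
    have "sum f t = sum f (t \<inter> t')"
      using ft t by (intro sum.mono_neutral_right) (auto simp: mem_realization_single)
    then have s1: "sum f (t \<inter> t') = 1" using t by (simp add: mem_realization_single)
    have "card (t \<inter> t') \<le> 1"
    proof (rule ccontr)
      assume "\<not> card (t \<inter> t') \<le> 1"
      then obtain e where "e \<subseteq> t \<inter> t'" "card e = 2"
        by (metis not_less_eq_eq obtain_subset_with_card_n One_nat_def Suc_1)
      then show False using no t ft by (auto simp: edges_def)
    qed
    moreover have "t \<inter> t' \<noteq> {}" using s1 by auto
    ultimately have "card (t \<inter> t') = 1"
      using ft by (metis card_eq_0_iff finite_Int le_antisym less_one not_le)
    then obtain a where a: "t \<inter> t' = {a}" by (rule card_1_singletonE)
    then have "f \<in> realization {{a}}" using s1 t by (auto simp: mem_realization_single)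
    then have "f = pt a" by (auto simp: mem_realization_single pt_apply)
    moreover have "a \<in> vertices L" using a ft by (auto simp: vertices_def)
    ultimately show False using f by blast
  qed
  moreover have "realization B \<inter> (realization L - ?W) \<noteq> {}" if B: "B \<subseteq> L" "B \<noteq> {}" for B
  proof -
    obtain t where t: "t \<in> B" using B by blast
    have t3: "card t = 3" "finite t" "t \<noteq> {}" using t B L(3) fin by force+
    have "centroid t \<in> realization {t}" using t3 by (intro centroid_in_realization_single) auto
    moreover have "centroid t \<noteq> pt a" for a
      using t3 by (auto simp: centroid_def fun_eq_iff intro!: exI[of _ a])
    ultimately have "centroid t \<in> realization B \<inter> (realization L - ?W)"
      using t B by (subst (1 2) realization_eq_UN) blast
    then show ?thesis by blast
  qed
  from this[of A] this[of "L - A"] A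
  have "realization A \<inter> (realization L - ?W) \<noteq> {}" "realization (L - A) \<inter> (realization L - ?W) \<noteq> {}" by auto
  ultimately show False unfolding connected_closed by meson
qed

section \<open>Every edge of a triangulated sphere lies in exactly two triangles\<close>

text \<open>Two triangles already contain a disc about the midpoint of the edge. By invariance of
  domain this disc is open in the sphere, so it would have to contain points of the third triangle
  close to the midpoint.\<close>

lemma sphere_triangles_at_edge_le_2:
  fixes L :: "'v set set"
  assumes S: "comb_2_sphere L" and t: "{a, b, c} \<in> L" "{a, b, d} \<in> L" "{a, b, e} \<in> L"
    and ne: "distinct [a, b, c, d, e]"
  shows False
proof -
  let ?X = "realization L"
  have X: "?X homeomorphic sphere (0 :: real^3) 1" using S by (simp add: comb_2_sphere_def)
  have "pt a \<in> realization {{a, b, c}}" by (intro centroid_in_realization_single) auto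
  then have "pt a \<in> ?X" using t(1) by (subst realization_eq_UN) blast
  then obtain H G where HG: "homeomorphism (?X - {pt a}) (UNIV::complex set) H G"
    using homeomorphic_sphere_punctured[OF X] unfolding homeomorphic_def by blast
  have GH: "\<And>x. x \<in> ?X - {pt a} \<Longrightarrow> G (H x) = x" and contH: "continuous_on (?X - {pt a}) H"
    using HG by (auto simp: homeomorphism_def)
  \<comment> \<open>The two triangles unfolded along their common edge: \<open>Re z\<close> moves
    along the edge, \<open>Im z\<close> is the weight of \<open>c\<close> if positive and minus the
    weight of \<open>d\<close> if negative, and \<open>a\<close> and \<open>b\<close> pay for it in
    equal parts. Radius 1/4 keeps the weights of \<open>a\<close> and \<open>b\<close> positive, so
    that the puncture at \<open>pt a\<close> is avoided.\<close>
  define \<phi> :: "complex \<Rightarrow> 'v \<Rightarrow> real" where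
    "\<phi> z = (\<lambda>x. if x = a then 1/2 - Re z - \<bar>Im z\<bar> / 2 else if x = b then 1/2 + Re z - \<bar>Im z\<bar> / 2
        else if x = c then max (Im z) 0 else if x = d then max (- Im z) 0 else 0)" for z
  \<comment> \<open>The segment from the midpoint of the edge towards \<open>e\<close> in the third
    triangle.\<close>
  define \<psi> :: "real \<Rightarrow> 'v \<Rightarrow> real" where
    "\<psi> s = (\<lambda>x. if x = a then (1 - s) / 2 else if x = b then (1 - s) / 2 else if x = e then s else 0)" for s
  let ?B = "ball (0::complex) (1/4)"
  have \<phi>X: "\<phi> z \<in> ?X - {pt a}" if "z \<in> ?B" for z
  proof -
    have z: "\<bar>Re z\<bar> < 1/4" "\<bar>Im z\<bar> < 1/4"
      using that abs_Re_le_cmod[of z] abs_Im_le_cmod[of z] by auto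
    have "\<phi> z \<in> realization {{a, b, c}} \<or> \<phi> z \<in> realization {{a, b, d}}"
    proof (cases "Im z \<ge> 0")
      case True
      then have "\<phi> z \<in> realization {{a, b, c}}"
        using ne z by (intro realization_singleI) (auto simp: \<phi>_def abs_if split: if_splits)
      then show ?thesis ..
    next
      case False
      then have "\<phi> z \<in> realization {{a, b, d}}"
        using ne z by (intro realization_singleI) (auto simp: \<phi>_def abs_if split: if_splits)
      then show ?thesis ..
    qed
    then have "\<phi> z \<in> ?X" using t by (subst realization_eq_UN) blast
    moreover have "\<phi> z b \<noteq> pt a b" using ne z by (auto simp: \<phi>_def pt_apply abs_if split: if_splits)
    ultimately show ?thesis by force
  qed
  have \<psi>X: "\<psi> s \<in> ?X - {pt a}" if "s \<in> {0..1/2}" for s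
  proof -
    have "\<psi> s \<in> realization {{a, b, e}}"
      using ne that by (intro realization_singleI) (auto simp: \<psi>_def)
    then have "\<psi> s \<in> ?X" using t by (subst realization_eq_UN) blast
    moreover have "\<psi> s b \<noteq> pt a b" using ne that by (auto simp: \<psi>_def pt_apply)
    ultimately show ?thesis by force
  qed
  have "continuous_on ?B \<phi>"
  proof (rule continuous_on_coordinatewise_then_product)
    fix i show "continuous_on ?B (\<lambda>z. \<phi> z i)"
      unfolding \<phi>_def by (cases "i = a"; cases "i = b"; cases "i = c"; cases "i = d") (auto intro!: continuous_intros)
  qed
  then have "continuous_on ?B (\<lambda>z. H (\<phi> z))"
    using \<phi>X by (intro continuous_on_compose2[OF contH]) auto
  moreover have "inj_on (\<lambda>z. H (\<phi> z)) ?B"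
  proof (rule inj_onI)
    fix z w assume zw: "z \<in> ?B" "w \<in> ?B" "H (\<phi> z) = H (\<phi> w)"
    have eq: "\<phi> z = \<phi> w" using GH[OF \<phi>X[OF zw(1)]] GH[OF \<phi>X[OF zw(2)]] zw(3) by metis
    have "max (Im z) 0 = max (Im w) 0" "max (- Im z) 0 = max (- Im w) 0"
      "1/2 - Re z - \<bar>Im z\<bar> / 2 = 1/2 - Re w - \<bar>Im w\<bar> / 2"
      using fun_cong[OF eq, of c] fun_cong[OF eq, of d] fun_cong[OF eq, of a] ne by (auto simp: \<phi>_def)
    then show "z = w" by (auto simp: complex_eq_iff max_def split: if_splits)
  qed
  ultimately have op: "open ((\<lambda>z. H (\<phi> z)) ` ?B)" by (intro invariance_of_domain) auto
  have "continuous_on {0..1/2} \<psi>"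
  proof (rule continuous_on_coordinatewise_then_product)
    fix i show "continuous_on {0..1/2} (\<lambda>s. \<psi> s i)"
      unfolding \<psi>_def by (cases "i = a"; cases "i = b"; cases "i = e") (auto intro!: continuous_intros)
  qed
  then have "continuous_on {0..1/2} (\<lambda>s. H (\<psi> s))"
    using \<psi>X by (intro continuous_on_compose2[OF contH]) auto
  then obtain A where A: "open A" "A \<inter> {0..1/2} = (\<lambda>s. H (\<psi> s)) -` ((\<lambda>z. H (\<phi> z)) ` ?B) \<inter> {0..1/2}"
    using op unfolding continuous_on_open_invariant by metis
  \<comment> \<open>Both maps pass through the midpoint, so some \<open>\<psi> s\<close> with
    \<open>s > 0\<close> lies in the open disc; its coordinate at \<open>e\<close> is
    \<open>s\<close>, whereas that of every \<open>\<phi> z\<close> is 0.\<close>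
  have "\<psi> 0 = \<phi> 0" using ne by (auto simp: \<phi>_def \<psi>_def)
  then have "0 \<in> A" using A(2) by (metis (no_types, lifting) IntD1 IntI atLeastAtMost_iff centre_in_ball divide_nonneg_pos image_eqI order_refl vimageI zero_less_divide_1_iff zero_less_numeral zero_le_one)
  then obtain r where r: "r > 0" "ball 0 r \<subseteq> A" using A(1) by (meson openE)
  define s where "s = min (r / 2) (1/2)"
  have s: "s > 0" "s \<in> {0..1/2}" "s \<in> A" using r by (auto simp: s_def subset_iff)
  then obtain z where z: "z \<in> ?B" "H (\<psi> s) = H (\<phi> z)" using A(2) by blast
  have "\<psi> s = \<phi> z" using GH[OF \<phi>X[OF z(1)]] GH[OF \<psi>X[OF s(2)]] z(2) by metis
  from fun_cong[OF this, of e] show False using s(1) ne by (auto simp: \<phi>_def \<psi>_def)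
qed

text \<open>With a single triangle at the edge, the sphere near the midpoint would be a half disc
  with the midpoint on its rim. An open part of the plane would then map injectively into a closed
  half plane and reach its boundary, against invariance of domain.\<close>

lemma sphere_triangles_at_edge_ge_2:
  fixes L :: "'v set set"
  assumes S: "comb_2_sphere L" and t: "{a, b, c} \<in> L" and ne: "distinct [a, b, c]"
  shows "\<exists>t\<in>L. {a, b} \<subseteq> t \<and> t \<noteq> {a, b, c}"
proof (rule ccontr)
  assume no: "\<not> (\<exists>t\<in>L. {a, b} \<subseteq> t \<and> t \<noteq> {a, b, c})"
  let ?X = "realization L"
  have X: "?X homeomorphic sphere (0 :: real^3) 1" using S by (simp add: comb_2_sphere_def)
  have "pt a \<in> realization {{a, b, c}}" by (intro centroid_in_realization_single) auto
  then have "pt a \<in> ?X" using t by (subst realization_eq_UN) blast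
  then obtain H G where HG: "homeomorphism (?X - {pt a}) (UNIV::complex set) H G"
    using homeomorphic_sphere_punctured[OF X] unfolding homeomorphic_def by blast
  have GH: "\<And>x. x \<in> ?X - {pt a} \<Longrightarrow> G (H x) = x" and HG1: "\<And>z. H (G z) = z"
    and Gim: "range G = ?X - {pt a}" and contG: "continuous_on UNIV G"
    using HG by (auto simp: homeomorphism_def)
  have contGi: "continuous_on A (\<lambda>z. G z i)" for A i
    using continuous_on_product_then_coordinatewise[OF contG] continuous_on_subset by blast
  \<comment> \<open>The chart domain of the points supported on triangles that contain both
    \<open>a\<close> and \<open>b\<close>; by assumption there is only one such triangle.\<close>
  define W where "W = {z. 0 < G z a} \<inter> {z. 0 < G z b}"
  have "open W" unfolding W_def by (intro open_Int open_Collect_less continuous_on_const contGi)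
  have Wt: "G z \<in> realization {{a, b, c}}" if "z \<in> W" for z
  proof -
    have "G z \<in> ?X" using Gim by blast
    then obtain t' where t': "t' \<in> L" "G z \<in> realization {t'}" by (subst (asm) realization_eq_UN) blast
    have "{a, b} \<subseteq> t'" using t'(2) that by (auto simp: mem_realization_single W_def)
    then have "t' = {a, b, c}" using no t'(1) by blast
    then show ?thesis using t' by simp
  qed
  have sum1: "G z a + G z b + G z c = 1" "G z c \<ge> 0" "\<And>x. x \<notin> {a, b, c} \<Longrightarrow> G z x = 0" if "z \<in> W" for z
    using Wt[OF that] ne by (auto simp: mem_realization_single)
  \<comment> \<open>Position along the edge and height above it. The three coordinates sum to 1, so
    these two numbers determine the point.\<close>
  define \<pi> where "\<pi> z = Complex (G z a - G z b) (G z c)" for z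
  have "continuous_on W \<pi>"
    unfolding \<pi>_def Complex_eq by (intro continuous_intros contGi continuous_on_of_real)
  moreover have "inj_on \<pi> W"
  proof (rule inj_onI)
    fix z w assume zw: "z \<in> W" "w \<in> W" "\<pi> z = \<pi> w"
    then have "G z c = G w c" "G z a = G w a" "G z b = G w b"
      using sum1(1)[OF zw(1)] sum1(1)[OF zw(2)] by (auto simp: \<pi>_def)
    moreover have "G z x = G w x" if "x \<notin> {a, b, c}" for x using that sum1(3) zw by simp
    ultimately have "G z x = G w x" for x by (cases "x \<in> {a, b, c}") auto
    then have "G z = G w" ..
    then show "z = w" using HG1 by metis
  qed
  ultimately have op: "open (\<pi> ` W)" using \<open>open W\<close> by (intro invariance_of_domain) auto
  let ?m = "centroid {a, b}"
  have "?m \<in> realization {{a, b, c}}" by (intro centroid_in_realization_single) auto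
  then have "?m \<in> ?X" using t by (subst realization_eq_UN) blast
  moreover have "?m b \<noteq> pt a b" using ne by (simp add: centroid_def)
  ultimately have "G (H ?m) = ?m" by (intro GH) force
  then have "H ?m \<in> W" "\<pi> (H ?m) = 0"
    using ne by (auto simp: W_def \<pi>_def centroid_def complex_eq_iff)
  then have "0 \<in> \<pi> ` W" by (metis image_eqI)
  then obtain r where r: "r > 0" "ball 0 r \<subseteq> \<pi> ` W" using op by (meson openE)
  \<comment> \<open>A point just beyond the edge: its height would be a negative coordinate at
    \<open>c\<close>.\<close>
  have "Complex 0 (- r / 2) \<in> ball 0 r" using r by (simp add: cmod_def)
  then obtain z where "z \<in> W" "Complex 0 (- r / 2) = \<pi> z" using r by blast
  then show False using sum1(2)[of z] r by (simp add: \<pi>_def)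
qed

lemma sphere_triangles_at_edge:
  fixes L :: "'v set set"
  assumes S: "comb_2_sphere L" and e: "e \<in> edges L"
  shows "card {t \<in> L. e \<subseteq> t} = 2"
proof -
  have L: "finite L" "\<And>t. t \<in> L \<Longrightarrow> card t = 3" using S by (auto simp: comb_2_sphere_def)
  obtain a b where ab: "e = {a, b}" "a \<noteq> b" using e by (auto simp: edges_def card_2_iff)
  have third: "\<exists>c. t = {a, b, c} \<and> c \<noteq> a \<and> c \<noteq> b" if "t \<in> L" "e \<subseteq> t" for t
  proof -
    have "card (t - e) = 1" using L(2)[OF that(1)] that(2) ab by (subst card_Diff_subset) auto
    then obtain c where "t - e = {c}" by (rule card_1_singletonE)
    then show ?thesis using that ab by (intro exI[of _ c]) auto
  qed
  obtain t where t: "t \<in> L" "e \<subseteq> t" using e by (auto simp: edges_def)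
  obtain c where c: "t = {a, b, c}" "c \<noteq> a" "c \<noteq> b" using third[OF t] by blast
  obtain t' where t': "t' \<in> L" "e \<subseteq> t'" "t' \<noteq> t"
    using sphere_triangles_at_edge_ge_2[OF S, of a b c] t c ab by auto
  obtain d where d: "t' = {a, b, d}" "d \<noteq> a" "d \<noteq> b" using third[OF t'(1,2)] by blast
  have "u \<in> {t, t'}" if u: "u \<in> L" "e \<subseteq> u" for u
  proof (rule ccontr)
    assume "u \<notin> {t, t'}"
    moreover obtain f where f: "u = {a, b, f}" "f \<noteq> a" "f \<noteq> b" using third[OF u] by blast
    ultimately have "distinct [a, b, c, d, f]" using c d f ab t' by auto
    then show False using sphere_triangles_at_edge_le_2[OF S, of a b c d f] t t' u c d f by blast
  qed
  then have "{t \<in> L. e \<subseteq> t} = {t, t'}" using t t' by auto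
  then show ?thesis using t' by simp
qed

section \<open>Spanning trees, cycles in graphs, and the bound on triangles\<close>

text \<open>Grows a spanning tree of the dual graph: the cut condition always offers an edge from
  the set \<open>P\<close> of triangles reached so far to a new one. The size of \<open>D\<close> is
  only bounded from above, since the new edge may be in \<open>D\<close> already.\<close>

lemma linked_by_few_edges:
  assumes "linked_by E L" "finite L" "L \<noteq> {}"
  shows "\<exists>D\<subseteq>E. finite D \<and> linked_by D L \<and> card D + 1 \<le> card L"
proof -
  let ?P = "\<lambda>n. \<exists>P D. P \<subseteq> L \<and> card P = n \<and> D \<subseteq> E \<and> finite D \<and> linked_by D P \<and> card D + 1 \<le> n"
  have "?P (Suc n)" if "Suc n \<le> card L" for n
    using that
  proof (induction n)
    case 0
    obtain t where "t \<in> L" using assms by blast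
    moreover have "linked_by {} {t}" by (auto simp: linked_by_def)
    ultimately show ?case by (intro exI[of _ "{t}"] exI[of _ "{}"]) auto
  next
    case (Suc n)
    then obtain P D where PD: "P \<subseteq> L" "card P = Suc n" "D \<subseteq> E" "finite D" "linked_by D P" "card D + 1 \<le> Suc n"
      by auto
    then have "P \<noteq> {}" "P \<noteq> L" using Suc.prems by auto
    then obtain t t' e where t: "t \<in> P" "t' \<in> L - P" "e \<in> E" "e \<subseteq> t" "e \<subseteq> t'"
      using assms(1) PD(1) unfolding linked_by_def by meson
    have "linked_by (insert e D) (insert t' P)"
      unfolding linked_by_def
    proof (intro allI impI)
      fix A assume A: "A \<subseteq> insert t' P" "A \<noteq> {}" "A \<noteq> insert t' P"
      show "\<exists>s\<in>A. \<exists>s'\<in>insert t' P - A. \<exists>f\<in>insert e D. f \<subseteq> s \<and> f \<subseteq> s'"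
      \<comment> \<open>A cut of the enlarged set either separates \<open>t'\<close> from all of
        \<open>P\<close>, and \<open>e\<close> crosses it, or it splits \<open>P\<close>, and an old
        edge crosses it.\<close>
      proof (cases "A \<inter> P = {} \<or> A \<inter> P = P")
        case True
        then have "A = {t'} \<or> A = P" using A by blast
        then show ?thesis using t by auto
      next
        case False
        then obtain s s' f where "s \<in> A \<inter> P" "s' \<in> P - A \<inter> P" "f \<in> D" "f \<subseteq> s" "f \<subseteq> s'"
          using PD(5) unfolding linked_by_def by (metis inf_le2)
        then show ?thesis by blast
      qed
    qed
    moreover have "finite P" using PD(1) assms(2) finite_subset by blast
    ultimately show ?case using PD t
      by (intro exI[of _ "insert t' P"] exI[of _ "insert e D"]) (auto intro: card_insert_le_m1 simp: card_insert_if)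
  qed
  moreover obtain n where n: "card L = Suc n" using assms by (metis card_0_eq not0_implies_Suc)
  ultimately obtain P D where "P \<subseteq> L" "card P = card L" "D \<subseteq> E" "finite D" "linked_by D P" "card D + 1 \<le> card L"
    by (metis order_refl)
  moreover have "P = L" using \<open>P \<subseteq> L\<close> \<open>card P = card L\<close> assms by (meson card_subset_eq)
  ultimately show ?thesis by blast
qed

text \<open>All neighbours of the first vertex of a longest path lie on the path. One of them is not
  the second vertex, and the edge back from it closes a cycle with at least three vertices.\<close>

lemma cycle_exists_min_degree_2:
  assumes "finite W" "W \<noteq> {}"
    and deg: "\<And>v. v \<in> W \<Longrightarrow> \<exists>x y. x \<noteq> y \<and> x \<noteq> v \<and> y \<noteq> v \<and> x \<in> W \<and> y \<in> W \<and> {v, x} \<in> R \<and> {v, y} \<in> R"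
  shows "\<exists>a vs. cycle_in R a vs"
proof -
  let ?Q = "\<lambda>vs. vs \<noteq> [] \<and> distinct vs \<and> set vs \<subseteq> W \<and> successively (\<lambda>x y. {x, y} \<in> R) vs"
  obtain v where "v \<in> W" using assms by blast
  then have "?Q [v]" by simp
  moreover have "\<forall>vs. ?Q vs \<longrightarrow> length vs \<le> card W"
    using assms(1) by (metis card_mono distinct_card)
  ultimately obtain vs where vs: "?Q vs" and max: "\<And>ws. ?Q ws \<Longrightarrow> length ws \<le> length vs"
    using ex_has_greatest_nat[of ?Q "[v]" length "Suc (card W)"] by (metis (no_types, lifting) less_Suc_eq_le)
  obtain a us where a: "vs = a # us" using vs by (cases vs) auto
  have aW: "a \<in> W" using vs a by simp
  have nb: "x \<in> set us" if "x \<in> W" "{a, x} \<in> R" "x \<noteq> a" for x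
  proof (rule ccontr)
    assume "x \<notin> set us"
    then have "?Q (x # vs)" using vs a that by (auto simp: insert_commute)
    from max[OF this] show False by simp
  qed
  obtain x where x: "x \<in> set us" "x \<noteq> hd us" "{a, x} \<in> R"
    using deg[OF aW] nb by metis
  obtain ps qs where pq: "us = ps @ x # qs" using x(1) split_list by metis
  have "ps \<noteq> []" using pq x(2) by auto
  have "cycle_in R a (ps @ [x])"
    unfolding cycle_in_def
  proof (intro conjI)
    show "distinct (a # ps @ [x])" using vs a pq by auto
    show "2 \<le> length (ps @ [x])" using \<open>ps \<noteq> []\<close> by (cases ps) auto
    show "{a, hd (ps @ [x])} \<in> R" using vs a pq \<open>ps \<noteq> []\<close> by (cases ps) auto
    show "{last (ps @ [x]), a} \<in> R" using x by (simp add: insert_commute)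
    have "successively (\<lambda>x y. {x, y} \<in> R) ((ps @ [x]) @ qs)" using vs a pq by (simp add: successively_Cons)
    then show "successively (\<lambda>x y. {x, y} \<in> R) (ps @ [x])" by (subst (asm) successively_append_iff) simp
  qed
  then show ?thesis by blast
qed

text \<open>Deleting a vertex of degree at most 1 costs at most one edge and preserves the
  inequality; when no such vertex is left, the minimum degree is 2.\<close>

lemma cycle_exists_many_edges:
  assumes "finite W" "W \<noteq> {}" "\<And>e. e \<in> R \<Longrightarrow> card e = 2 \<and> e \<subseteq> W" "card W \<le> card R"
  shows "\<exists>a vs. cycle_in R a vs"
  using assms
proof (induction "card W" arbitrary: W R)
  case 0
  then show ?case by simp
next
  case (Suc n)
  have finR: "finite R" using Suc.prems(1,3) by (meson Pow_iff finite_Pow_iff finite_subset subsetI)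
  show ?case
  proof (cases "\<exists>v\<in>W. card {e\<in>R. v \<in> e} \<le> 1")
    case True
    then obtain v where v: "v \<in> W" "card {e\<in>R. v \<in> e} \<le> 1" by blast
    let ?R = "{e\<in>R. v \<notin> e}"
    have "R = {e\<in>R. v \<in> e} \<union> ?R" by blast
    then have "card R \<le> card {e\<in>R. v \<in> e} + card ?R" by (metis card_Un_le)
    then have c: "card (W - {v}) \<le> card ?R" using v Suc.prems by simp
    have "W - {v} \<noteq> {}"
    proof
      assume "W - {v} = {}"
      then have "W = {v}" using v by blast
      have "e \<notin> R" for e
      proof
        assume "e \<in> R"
        then have "card e = 2" "e \<subseteq> {v}" using Suc.prems(3) \<open>W = {v}\<close> by auto
        then show False using card_mono[of "{v}" e] by simp
      qed
      then have "R = {}" by blast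
      then show False using Suc.prems \<open>W = {v}\<close> by simp
    qed
    moreover have "n = card (W - {v})" using Suc.hyps(2) v Suc.prems(1) by simp
    ultimately obtain a vs where "cycle_in ?R a vs"
      using Suc.hyps(1)[of "W - {v}" ?R] Suc.prems c by blast
    then have "cycle_in R a vs"
      unfolding cycle_in_def by (auto elim!: successively_mono)
    then show ?thesis by blast
  next
    case False
    show ?thesis
    proof (rule cycle_exists_min_degree_2[OF Suc.prems(1,2)])
      fix v assume v: "v \<in> W"
      then have "card {e\<in>R. v \<in> e} \<ge> Suc 1" using False by auto
      then obtain e1 e2 where e: "e1 \<in> R" "v \<in> e1" "e2 \<in> R" "v \<in> e2" "e1 \<noteq> e2"
        by (subst (asm) card_le_Suc_iff) (auto simp: card_le_Suc_iff)
      have "\<exists>x. e = {v, x} \<and> x \<noteq> v \<and> x \<in> W" if "e \<in> R" "v \<in> e" for e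
      proof -
        have "card e = 2" "e \<subseteq> W" using Suc.prems(3)[OF that(1)] by auto
        then obtain p q where "e = {p, q}" "p \<noteq> q" by (auto simp: card_2_iff)
        then show ?thesis using that(2) \<open>e \<subseteq> W\<close> by auto
      qed
      then show "\<exists>x y. x \<noteq> y \<and> x \<noteq> v \<and> y \<noteq> v \<and> x \<in> W \<and> y \<in> W \<and> {v, x} \<in> R \<and> {v, y} \<in> R"
        using e by metis
    qed
  qed
qed

lemma finite_edges:
  assumes "finite L" "\<And>t. t \<in> L \<Longrightarrow> finite t" shows "finite (edges L)"
proof -
  have "edges L \<subseteq> Pow (\<Union>L)" by (auto simp: edges_def)
  moreover have "finite (Pow (\<Union>L))" using assms by simp
  ultimately show ?thesis using finite_subset by blast
qed

text \<open>With m vertices, E edges and F triangles, the tree has at most F - 1 edges and the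
  acyclic rest at most m - 1, so E <= F + m - 2. Inserting 2 E = 3 F gives F <= 2 m - 4.\<close>

lemma sphere_card_triangles_le:
  fixes L :: "'v set set"
  assumes S: "comb_2_sphere L"
  shows "card L + 4 \<le> 2 * card (vertices L)"
proof -
  have L: "finite L" "L \<noteq> {}" "\<And>t. t \<in> L \<Longrightarrow> card t = 3" using S by (auto simp: comb_2_sphere_def)
  have fin: "finite t" if "t \<in> L" for t using L(3)[OF that] card.infinite by fastforce
  have finE: "finite (edges L)" using L fin by (intro finite_edges) auto
  have finV: "finite (vertices L)" using L fin by (auto simp: vertices_def)
  have neV: "vertices L \<noteq> {}" using L by (force simp: vertices_def)
  obtain D where D: "D \<subseteq> edges L" "finite D" "linked_by D L" "card D + 1 \<le> card L"
    using linked_by_few_edges[OF sphere_linked_by_edges[OF S] L(1,2)] by blast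
  let ?R = "edges L - D"
  have "card ?R < card (vertices L)"
  proof (rule ccontr)
    assume "\<not> card ?R < card (vertices L)"
    then obtain a vs where "cycle_in ?R a vs"
      using cycle_exists_many_edges[OF finV neV, of ?R] by (force simp: edges_def vertices_def)
    moreover have "\<forall>e\<in>D. card e = 2" using D by (auto simp: edges_def)
    ultimately show False using sphere_no_cycle_off_linking_edges[OF S D(3), of ?R] by blast
  qed
  moreover have "card (edges L) = card D + card ?R"
    using D finE by (simp add: card_Diff_subset card_mono)
  moreover have "2 * card (edges L) = 3 * card L"
  proof -
    have "(\<Sum>t\<in>L. card {e\<in>edges L. e \<subseteq> t}) = 2 * card (edges L)"
      by (rule sum_multicount[OF L(1) finE]) (use sphere_triangles_at_edge[OF S] in auto)
    moreover have "card {e\<in>edges L. e \<subseteq> t} = 3" if "t \<in> L" for t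
    proof -
      have "{e\<in>edges L. e \<subseteq> t} = {e. e \<subseteq> t \<and> card e = 2}" using that by (auto simp: edges_def)
      moreover have "(3::nat) choose 2 = 3" by (simp add: numeral_eq_Suc)
      ultimately show ?thesis using n_subsets[OF fin[OF that], of 2] L(3)[OF that] by simp
    qed
    ultimately show ?thesis by simp
  qed
  ultimately show ?thesis using D(4) by linarith
qed

section \<open>The lower bound for slicings\<close>

context
  fixes K :: "'v set set"
  assumes K: "comb_3_manifold K"
begin

lemma
  shows manifold_finite: "finite K"
    and manifold_facet: "t \<in> K \<Longrightarrow> finite t \<and> card t = 4"
    and manifold_link: "v \<in> vertices K \<Longrightarrow> comb_2_sphere (vlink K v)"
    and manifold_finite_vertices: "finite (vertices K)"
  using K by (auto simp: comb_3_manifold_def vertices_def)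

lemma finite_faces: "finite (faces K)"
proof -
  have "faces K \<subseteq> Pow (vertices K)" by (auto simp: faces_def vertices_def)
  then show ?thesis using manifold_finite_vertices finite_subset by blast
qed

lemma card_vlink: "card (vlink K v) = card {t \<in> K. v \<in> t}"
proof -
  have "vlink K v = (\<lambda>t. t - {v}) ` {t \<in> K. v \<in> t}" by (auto simp: vlink_def)
  moreover have "inj_on (\<lambda>t. t - {v}) {t \<in> K. v \<in> t}" by (auto simp: inj_on_def)
  ultimately show ?thesis by (simp add: card_image)
qed

lemma sum_card_vlink: "(\<Sum>v\<in>vertices K. card (vlink K v)) = 4 * card K"
proof -
  have "(\<Sum>v\<in>vertices K. card {t \<in> K. v \<in> t}) = 4 * card K"
  proof (rule sum_multicount[OF manifold_finite_vertices manifold_finite])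
    show "\<forall>t\<in>K. card {v \<in> vertices K. v \<in> t} = 4"
    proof
      fix t assume t: "t \<in> K"
      then have "{v \<in> vertices K. v \<in> t} = t" by (auto simp: vertices_def)
      then show "card {v \<in> vertices K. v \<in> t} = 4" using manifold_facet[OF t] by simp
    qed
  qed
  then show ?thesis by (simp add: card_vlink)
qed

text \<open>A link has at most n - 1 vertices, hence at most 2 (n - 1) - 4 = 2 n - 6 triangles; the
  sum over all links counts each tetrahedron four times. Integers avoid truncation in n - 3.\<close>

lemma manifold_card_facets_le:
  "2 * int (card K) \<le> int (card (vertices K)) * (int (card (vertices K)) - 3)"
proof -
  let ?n = "card (vertices K)"
  have "int (card (vlink K v)) \<le> 2 * int ?n - 6" if v: "v \<in> vertices K" for v
  proof -
    have "vertices (vlink K v) \<subseteq> vertices K - {v}" by (auto simp: vertices_def vlink_def)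
    then have "card (vertices (vlink K v)) \<le> ?n - 1"
      using v manifold_finite_vertices by (metis card_Diff_singleton card_mono finite_Diff)
    moreover have "?n > 0" using v manifold_finite_vertices card_gt_0_iff by blast
    ultimately show ?thesis using sphere_card_triangles_le[OF manifold_link[OF v]] by linarith
  qed
  then have "(\<Sum>v\<in>vertices K. int (card (vlink K v))) \<le> int ?n * (2 * int ?n - 6)"
    by (rule sum_bounded_above)
  then have "int (4 * card K) \<le> int ?n * (2 * int ?n - 6)"
    unfolding sum_card_vlink[symmetric] by simp
  then show ?thesis by (simp add: algebra_simps)
qed

text \<open>In the link of a vertex \<open>v\<close> of \<open>s\<close>, the triangle
  \<open>s\<close> becomes the edge \<open>s - {v}\<close>, and the tetrahedra containing
  \<open>s\<close> become the triangles at that edge.\<close>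

lemma facets_at_triangle:
  assumes s: "s \<in> faces K" "card s = 3"
  shows "card {t \<in> K. s \<subseteq> t} = 2"
proof -
  obtain u where u: "u \<in> K" "s \<subseteq> u" using s by (auto simp: faces_def)
  obtain v where v: "v \<in> s" using s by fastforce
  then have vK: "v \<in> vertices K" using u by (auto simp: vertices_def)
  have "finite s" using s(2) card.infinite by fastforce
  then have "card (s - {v}) = 2" using s v by simp
  moreover have "u - {v} \<in> vlink K v" using u v by (auto simp: vlink_def)
  moreover have "s - {v} \<subseteq> u - {v}" using u by blast
  ultimately have "s - {v} \<in> edges (vlink K v)" by (auto simp: edges_def)
  from sphere_triangles_at_edge[OF manifold_link[OF vK] this]
  have "card {t \<in> vlink K v. s - {v} \<subseteq> t} = 2" .
  moreover have "{t \<in> vlink K v. s - {v} \<subseteq> t} = (\<lambda>t. t - {v}) ` {t \<in> K. s \<subseteq> t}"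
  proof (intro equalityI subsetI)
    fix t' assume "t' \<in> {t \<in> vlink K v. s - {v} \<subseteq> t}"
    then obtain t where "t \<in> K" "v \<in> t" "t' = t - {v}" "s - {v} \<subseteq> t - {v}" by (auto simp: vlink_def)
    then show "t' \<in> (\<lambda>t. t - {v}) ` {t \<in> K. s \<subseteq> t}" by blast
  qed (use v in \<open>auto simp: vlink_def\<close>)
  moreover have "inj_on (\<lambda>t. t - {v}) {t \<in> K. s \<subseteq> t}" using v by (auto simp: inj_on_def)
  ultimately show ?thesis by (simp add: card_image)
qed

context
  fixes V1 V2 :: "'v set"
  assumes P: "is_partition K V1 V2"
begin

lemma partition_facts:
  shows "V1 \<union> V2 = vertices K" "V1 \<inter> V2 = {}" "finite V1" "finite V2"
proof -
  show 1: "V1 \<union> V2 = vertices K" "V1 \<inter> V2 = {}" using P by (auto simp: is_partition_def)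
  show "finite V1" "finite V2" using manifold_finite_vertices 1 by (metis finite_Un)+
qed

lemma finite_bichromatic: "finite (bichromatic K V1 V2 d)"
  using finite_faces by (simp add: bichromatic_def)

lemma card_bichromatic_edges:
  assumes N: "two_neighborly K"
  shows "card (bichromatic K V1 V2 2) = card V1 * card V2"
proof -
  have "bichromatic K V1 V2 2 = (\<lambda>(x, y). {x, y}) ` (V1 \<times> V2)"
  proof (intro equalityI subsetI)
    fix s assume s: "s \<in> bichromatic K V1 V2 2"
    then obtain x y where xy: "x \<in> s" "x \<in> V1" "y \<in> s" "y \<in> V2" by (auto simp: bichromatic_def)
    then have "x \<noteq> y" using partition_facts by blast
    moreover have "card s = 2" using s by (simp add: bichromatic_def)
    ultimately have "s = {x, y}" using xy by (auto simp: card_2_iff)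
    then show "s \<in> (\<lambda>(x, y). {x, y}) ` (V1 \<times> V2)" using xy by auto
  next
    fix s assume "s \<in> (\<lambda>(x, y). {x, y}) ` (V1 \<times> V2)"
    then obtain x y where xy: "s = {x, y}" "x \<in> V1" "y \<in> V2" by auto
    then have "x \<noteq> y" "x \<in> vertices K" "y \<in> vertices K" using partition_facts by auto
    moreover then have "s \<in> faces K" using N xy by (simp add: two_neighborly_def)
    ultimately show "s \<in> bichromatic K V1 V2 2" using xy by (auto simp: bichromatic_def)
  qed
  moreover have "inj_on (\<lambda>(x, y). {x, y}) (V1 \<times> V2)"
    using partition_facts(2) by (auto simp: inj_on_def doubleton_eq_iff)
  ultimately show ?thesis by (simp add: card_image card_cartesian_product)
qed

lemma bichromatic_4: "bichromatic K V1 V2 4 = {t \<in> K. t \<inter> V1 \<noteq> {} \<and> t \<inter> V2 \<noteq> {}}"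
proof (intro equalityI subsetI)
  fix t assume t: "t \<in> bichromatic K V1 V2 4"
  then obtain u where u: "u \<in> K" "t \<subseteq> u" by (auto simp: bichromatic_def faces_def)
  then have "t = u" using t manifold_facet[OF u(1)] card_subset_eq[of u t] by (simp add: bichromatic_def)
  then show "t \<in> {t \<in> K. t \<inter> V1 \<noteq> {} \<and> t \<inter> V2 \<noteq> {}}" using t u by (auto simp: bichromatic_def)
qed (use manifold_facet in \<open>auto simp: bichromatic_def faces_def\<close>)

lemma card_Int_partition:
  assumes "t \<in> K" shows "card (t \<inter> V1) + card (t \<inter> V2) = 4"
proof -
  have "t \<subseteq> V1 \<union> V2" using assms partition_facts(1) by (auto simp: vertices_def)
  then have "t = (t \<inter> V1) \<union> (t \<inter> V2)" by blast
  moreover have "card ((t \<inter> V1) \<union> (t \<inter> V2)) = card (t \<inter> V1) + card (t \<inter> V2)"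
    using partition_facts by (intro card_Un_disjoint) auto
  ultimately show ?thesis using manifold_facet[OF assms] by simp
qed

text \<open>The number of sides of the slicing facet cut out of \<open>t\<close>. Removing a vertex
  of \<open>t\<close> leaves a bichromatic triangle unless that vertex is the only one in its
  class.\<close>

lemma card_bichromatic_triangles_in_facet:
  assumes t: "t \<in> bichromatic K V1 V2 4"
  shows "card {s \<in> bichromatic K V1 V2 3. s \<subseteq> t} = (if card (t \<inter> V1) = 2 \<and> card (t \<inter> V2) = 2 then 4 else 3)"
proof -
  have tK: "t \<in> K" and ne: "t \<inter> V1 \<noteq> {}" "t \<inter> V2 \<noteq> {}" using t by (auto simp: bichromatic_4)
  have t4: "finite t" "card t = 4" using manifold_facet[OF tK] by auto
  have tV: "t \<subseteq> V1 \<union> V2" using tK partition_facts(1) by (auto simp: vertices_def)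
  let ?f = "\<lambda>x. t - {x}"
  let ?G = "{x \<in> t. (t - {x}) \<inter> V1 \<noteq> {} \<and> (t - {x}) \<inter> V2 \<noteq> {}}"
  have "{s \<in> bichromatic K V1 V2 3. s \<subseteq> t} = ?f ` ?G"
  proof (intro equalityI subsetI)
    fix s assume s: "s \<in> {s \<in> bichromatic K V1 V2 3. s \<subseteq> t}"
    then have "card (t - s) = 1" using t4 by (subst card_Diff_subset) (auto simp: bichromatic_def intro: finite_subset)
    then obtain x where "t - s = {x}" by (rule card_1_singletonE)
    then have "s = t - {x}" "x \<in> t" using s by auto
    then show "s \<in> ?f ` ?G" using s by (auto simp: bichromatic_def)
  next
    fix s assume "s \<in> ?f ` ?G"
    then obtain x where x: "s = t - {x}" "x \<in> t" "s \<inter> V1 \<noteq> {}" "s \<inter> V2 \<noteq> {}" by auto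
    moreover have "card s = 3" using x t4 by simp
    moreover have "s \<in> faces K" using x tK by (auto simp: faces_def)
    ultimately show "s \<in> {s \<in> bichromatic K V1 V2 3. s \<subseteq> t}" by (auto simp: bichromatic_def)
  qed
  moreover have "inj_on ?f ?G" by (auto simp: inj_on_def)
  ultimately have eq: "card {s \<in> bichromatic K V1 V2 3. s \<subseteq> t} = card ?G" by (simp add: card_image)
  have c4: "card (t \<inter> V1) + card (t \<inter> V2) = 4" by (rule card_Int_partition[OF tK])
  have only: "card ?G = 3" if W: "W \<in> {V1, V2}" "card (t \<inter> W) = 1" for W
  proof -
    obtain w where w: "t \<inter> W = {w}" using W(2) by (rule card_1_singletonE)
    obtain W' where W': "{W, W'} = {V1, V2}" using W by auto
    have c3: "card (t \<inter> W') = 3" using c4 W(2) W' by (auto simp: doubleton_eq_iff)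
    have dis: "W \<inter> W' = {}" "t \<subseteq> W \<union> W'" using W' partition_facts(2) tV by (auto simp: doubleton_eq_iff)
    have "(t - {x}) \<inter> W' \<noteq> {}" for x
    proof
      assume "(t - {x}) \<inter> W' = {}"
      then have "t \<inter> W' \<subseteq> {x}" by blast
      then have "card (t \<inter> W') \<le> card {x}" by (intro card_mono) auto
      then show False using c3 by simp
    qed
    moreover have "(t - {x}) \<inter> W \<noteq> {} \<longleftrightarrow> x \<noteq> w" for x using w by blast
    ultimately have "?G = t - {w}" using W' by (auto simp: doubleton_eq_iff)
    moreover have "w \<in> t" using w by blast
    ultimately show ?thesis using t4 by simp
  qed
  have big: "(t - {x}) \<inter> W \<noteq> {}" if "card (t \<inter> W) = 2" for W x
  proof
    assume "(t - {x}) \<inter> W = {}"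
    then have "t \<inter> W \<subseteq> {x}" by blast
    then have "card (t \<inter> W) \<le> card {x}" by (intro card_mono) auto
    then show False using that by simp
  qed
  have pos: "card (t \<inter> V1) > 0" "card (t \<inter> V2) > 0" using ne t4 by (auto simp: card_gt_0_iff)
  consider "card (t \<inter> V1) = 2 \<and> card (t \<inter> V2) = 2" | "card (t \<inter> V1) = 1" | "card (t \<inter> V2) = 1"
    using c4 pos by linarith
  then have "card ?G = (if card (t \<inter> V1) = 2 \<and> card (t \<inter> V2) = 2 then 4 else 3)"
  proof cases
    case 1
    then have "?G = t" using big by auto
    then show ?thesis using 1 t4 by simp
  qed (use only[of V1] only[of V2] in auto)
  then show ?thesis using eq by simp
qed

text \<open>Counts pairs of an edge and a facet of the slicing: every edge lies in two facets, and a
  facet has three sides, or four if it is a quadrilateral.\<close>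

lemma double_count_bichromatic_triangles:
  "2 * card (bichromatic K V1 V2 3) = 3 * card (bichromatic K V1 V2 4) + slicing_quads K V1 V2"
proof -
  let ?T = "bichromatic K V1 V2 4" and ?Q = "\<lambda>t. card (t \<inter> V1) = 2 \<and> card (t \<inter> V2) = 2"
  have "(\<Sum>t\<in>?T. card {s \<in> bichromatic K V1 V2 3. s \<subseteq> t}) = 2 * card (bichromatic K V1 V2 3)"
  proof (rule sum_multicount[OF finite_bichromatic finite_bichromatic], rule ballI)
    fix s assume s: "s \<in> bichromatic K V1 V2 3"
    then have "{t \<in> ?T. s \<subseteq> t} = {t \<in> K. s \<subseteq> t}"
      unfolding bichromatic_4 by (auto simp: bichromatic_def)
    then show "card {t \<in> ?T. s \<subseteq> t} = 2"
      using facets_at_triangle s by (simp add: bichromatic_def)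
  qed
  moreover have "(\<Sum>t\<in>?T. card {s \<in> bichromatic K V1 V2 3. s \<subseteq> t}) = (\<Sum>t\<in>?T. 3 + (if ?Q t then 1 else 0))"
    by (rule sum.cong[OF refl]) (simp add: card_bichromatic_triangles_in_facet)
  moreover have "(\<Sum>t\<in>?T. 3 + (if ?Q t then 1 else 0)) = 3 * card ?T + card {t \<in> ?T. ?Q t}"
    using finite_bichromatic by (subst sum.distrib) (simp add: sum.If_cases Int_def)
  moreover have "{t \<in> ?T. ?Q t} = {t \<in> K. ?Q t}"
    unfolding bichromatic_4 by auto
  ultimately show ?thesis by (simp add: slicing_quads_def)
qed

text \<open>In 2 chi = 2 V - 2 E + 2 F the edge term is replaced by 2 E = 3 F + q, and V is |V1|
  |V2| by 2-neighborliness.\<close>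

lemma slicing_quads_plus_euler_char:
  assumes N: "two_neighborly K"
  shows "int (slicing_quads K V1 V2) + 2 * slicing_euler_char K V1 V2
    = 2 * int (card V1) * int (card V2) - int (card (bichromatic K V1 V2 4))"
  using double_count_bichromatic_triangles card_bichromatic_edges[OF N]
  unfolding slicing_euler_char_def by simp

end
end

lemma slicing_quads_lower_bound:
  fixes c :: real
  assumes K: "comb_3_manifold K" and N: "two_neighborly K" and P: "is_partition K V1 V2"
    and c: "real (card V1) + c = real (card V2) - c"
  shows "real (slicing_quads K V1 V2)
    \<ge> 4 * slicing_genus K V1 V2 + 3 * real (card (vertices K)) / 2 - (4 + 2 * c^2)"
proof -
  let ?n = "real (card (vertices K))" and ?a = "real (card V1)" and ?q = "real (slicing_quads K V1 V2)"
    and ?chi = "real_of_int (slicing_euler_char K V1 V2)" and ?T = "bichromatic K V1 V2 4"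
  note pf = partition_facts[OF K P]
  have b: "real (card V2) = ?a + 2 * c" using c by simp
  have "card (vertices K) = card V1 + card V2" using pf by (metis card_Un_disjoint)
  then have n: "?n = 2 * ?a + 2 * c" using b by simp
  have "card ?T \<le> card K"
    unfolding bichromatic_4[OF K P] using manifold_finite[OF K] by (intro card_mono) auto
  then have "2 * int (card ?T) \<le> int (card (vertices K)) * (int (card (vertices K)) - 3)"
    using manifold_card_facets_le[OF K] by linarith
  then have "real_of_int (2 * int (card ?T)) \<le> real_of_int (int (card (vertices K)) * (int (card (vertices K)) - 3))"
    by (simp only: of_int_le_iff)
  then have T: "2 * real (card ?T) \<le> ?n * (?n - 3)" by simp
  have "real_of_int (int (slicing_quads K V1 V2) + 2 * slicing_euler_char K V1 V2)
    = real_of_int (2 * int (card V1) * int (card V2) - int (card ?T))"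
    using slicing_quads_plus_euler_char[OF K P N] by simp
  then have "?q + 2 * ?chi = 2 * ?a * (?a + 2 * c) - real (card ?T)" using b by simp
  then have "?q + 2 * ?chi - 3 * ?n / 2 + 2 * c^2 \<ge> 0"
    using T unfolding n by (simp add: algebra_simps power2_eq_square)
  then show ?thesis unfolding slicing_genus_def by (simp add: field_simps)
qed

section \<open>Stacked spheres\<close>

text \<open>Four barycentric coordinates modulo a common constant form 3-space. Every nonzero class
  has a unique representative with least entry 0, and scaling it to sum 1 gives a boundary point; so
  rays from the origin correspond to boundary points.\<close>

lemma tetrahedron_boundary_homeomorphic_sphere:
  assumes ne: "distinct [a, b, c, d]"
  shows "realization {{a, b, c}, {a, b, d}, {a, c, d}, {b, c, d}} homeomorphic sphere (0::real^3) 1"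
    (is "?X homeomorphic ?S")
proof -
  have X_iff: "f \<in> ?X \<longleftrightarrow> (\<forall>x. x \<notin> {a, b, c, d} \<longrightarrow> f x = 0) \<and> (\<forall>x. 0 \<le> f x)
      \<and> f a + f b + f c + f d = 1 \<and> (f a = 0 \<or> f b = 0 \<or> f c = 0 \<or> f d = 0)" for f
    using ne by (subst realization_eq_UN) (auto simp: mem_realization_single)
  \<comment> \<open>The projection along (1, 1, 1, 1), normalised by making the coordinate at
    \<open>d\<close> zero.\<close>
  define y :: "('a \<Rightarrow> real) \<Rightarrow> real^3" where
    "y f = (f a - f d) *\<^sub>R axis 1 1 + (f b - f d) *\<^sub>R axis 2 1 + (f c - f d) *\<^sub>R axis 3 1" for f
  have y_nth: "y f $ 1 = f a - f d" "y f $ 2 = f b - f d" "y f $ 3 = f c - f d" for f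
    by (simp_all add: y_def axis_def)
  \<comment> \<open>The least of the entries of (z1, z2, z3, 0). Subtracting \<open>m z\<close> from
    all four makes them nonnegative with a zero among them, and \<open>s z\<close> is their sum
    afterwards.\<close>
  define m :: "real^3 \<Rightarrow> real" where "m z = min (min (z $ 1) (z $ 2)) (min (z $ 3) 0)" for z
  define s :: "real^3 \<Rightarrow> real" where "s z = z $ 1 + z $ 2 + z $ 3 - 4 * m z" for z
  define F where "F f = y f /\<^sub>R norm (y f)" for f
  define G :: "real^3 \<Rightarrow> 'a \<Rightarrow> real" where
    "G z = (\<lambda>x. if x = a then (z $ 1 - m z) / s z else if x = b then (z $ 2 - m z) / s z
       else if x = c then (z $ 3 - m z) / s z else if x = d then - m z / s z else 0)" for z
  have m_le: "m z \<le> z $ 1" "m z \<le> z $ 2" "m z \<le> z $ 3" "m z \<le> 0" for z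
    by (auto simp: m_def)
  have m_eq: "m z = z $ 1 \<or> m z = z $ 2 \<or> m z = z $ 3 \<or> m z = 0" for z
    by (auto simp: m_def min_def)
  have s_pos: "s z > 0" if "z \<noteq> 0" for z
  proof (rule ccontr)
    assume "\<not> s z > 0"
    then have "z $ 1 = 0" "z $ 2 = 0" "z $ 3 = 0" using m_le[of z] unfolding s_def by linarith+
    then have "z = 0" by (simp add: vec_eq_iff forall_3)
    then show False using that by simp
  qed
  have y_ne: "y f \<noteq> 0" if "f \<in> ?X" for f
  proof
    assume "y f = 0"
    then have "f a = f d" "f b = f d" "f c = f d" using y_nth[of f] by simp_all
    then show False using that unfolding X_iff by auto
  qed
  \<comment> \<open>Invariance under positive factors \<open>r\<close> absorbs the division by the
    norm in \<open>F\<close>.\<close>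
  have G_y: "G (r *\<^sub>R y f) = f" if f: "f \<in> ?X" and r: "r > 0" for f r
  proof -
    have nn: "r * f a \<ge> 0" "r * f b \<ge> 0" "r * f c \<ge> 0" "r * f d \<ge> 0" using f r by (auto simp: X_iff)
    have z: "r * f a = 0 \<or> r * f b = 0 \<or> r * f c = 0 \<or> r * f d = 0" using f unfolding X_iff by auto
    have "min (min (A - D) (B - D)) (min (C - D) 0) = - D"
      if "A \<ge> 0" "B \<ge> 0" "C \<ge> 0" "D \<ge> 0" "A = 0 \<or> B = 0 \<or> C = 0 \<or> D = 0" for A B C D :: real
      using that by (auto simp: min_def)
    from this[OF nn z] have m: "m (r *\<^sub>R y f) = - (r * f d)"
      by (simp add: m_def y_nth right_diff_distrib)
    have "s (r *\<^sub>R y f) = r * (f a + f b + f c + f d)"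
      unfolding s_def m by (simp add: y_nth algebra_simps)
    then have s: "s (r *\<^sub>R y f) = r" using f by (simp add: X_iff)
    show ?thesis
    proof
      fix x
      show "G (r *\<^sub>R y f) x = f x"
        using r f unfolding G_def m s by (auto simp: y_nth X_iff field_simps)
    qed
  qed
  have Gv: "G z a = (z $ 1 - m z) / s z" "G z b = (z $ 2 - m z) / s z" "G z c = (z $ 3 - m z) / s z"
    "G z d = - m z / s z" for z
    using ne by (auto simp: G_def)
  have y_G: "y (G z) = (1 / s z) *\<^sub>R z" for z
    by (simp add: vec_eq_iff forall_3 y_nth Gv diff_divide_distrib)
  have "homeomorphism ?X ?S F G"
  proof (rule homeomorphismI)
    have "continuous_on A y" for A
      unfolding y_def
      by (intro continuous_intros continuous_on_subset[OF continuous_on_product_coordinates]) auto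
    then show "continuous_on ?X F"
      unfolding F_def using y_ne by (intro continuous_intros) auto
    have m: "continuous_on A m" for A unfolding m_def by (intro continuous_intros)
    then have s: "continuous_on A s" for A unfolding s_def by (intro continuous_intros)
    show "continuous_on ?S G"
    proof (rule continuous_on_coordinatewise_then_product)
      fix i
      have "\<forall>z\<in>?S. s z \<noteq> 0" using s_pos by (metis less_irrefl norm_zero zero_neq_one mem_sphere_0)
      then show "continuous_on ?S (\<lambda>z. G z i)"
        unfolding G_def using m s
        by (cases "i = a"; cases "i = b"; cases "i = c"; cases "i = d") (auto intro!: continuous_intros)
    qed
    show "F ` ?X \<subseteq> ?S" using y_ne by (auto simp: F_def)
    show "G ` ?S \<subseteq> ?X"
    proof clarify
      fix z assume "z \<in> ?S"
      then have "z \<noteq> 0" by auto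
      then have sp: "s z > 0" by (rule s_pos)
      have out: "\<forall>x. x \<notin> {a, b, c, d} \<longrightarrow> G z x = 0" by (simp add: G_def)
      have "0 \<le> G z a" "0 \<le> G z b" "0 \<le> G z c" "0 \<le> G z d"
        unfolding Gv using m_le[of z] sp by (auto intro!: divide_nonneg_pos divide_nonpos_pos)
      then have "\<forall>x. 0 \<le> G z x" using out by (metis insertE order_refl singletonD)
      moreover have "(z $ 1 - m z) + (z $ 2 - m z) + (z $ 3 - m z) + - m z = s z" by (simp add: s_def)
      then have "G z a + G z b + G z c + G z d = 1"
        unfolding Gv add_divide_distrib[symmetric] using sp by simp
      moreover have "G z a = 0 \<or> G z b = 0 \<or> G z c = 0 \<or> G z d = 0"
        unfolding Gv using m_eq[of z] by auto
      ultimately show "G z \<in> ?X" unfolding X_iff using out by blast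
    qed
    show "G (F f) = f" if "f \<in> ?X" for f
      unfolding F_def using y_ne[OF that] by (intro G_y[OF that]) simp
    show "F (G z) = z" if "z \<in> ?S" for z
    proof -
      have "z \<noteq> 0" "norm z = 1" using that by auto
      then show ?thesis unfolding F_def y_G using s_pos[of z] by simp
    qed
  qed
  then show ?thesis unfolding homeomorphic_def by blast
qed

text \<open>The new vertex \<open>d\<close> is placed at the barycentre of the triangle:
  \<open>\<Psi>\<close> spreads the weight of \<open>d\<close> evenly over \<open>a\<close>,
  \<open>b\<close>, \<open>c\<close>, and \<open>\<Phi>\<close> collects the common part
  \<open>\<mu>\<close> of these three weights back into \<open>d\<close>.\<close>

lemma stellar_subdivision_homeomorphic:
  assumes card3: "\<And>t. t \<in> L \<Longrightarrow> card t = 3" and ne: "distinct [a, b, c, d]"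
    and d: "d \<notin> \<Union>L" "{a, b, c} \<notin> L"
  shows "realization ({{a, b, d}, {b, c, d}, {a, c, d}} \<union> L) homeomorphic realization (insert {a, b, c} L)"
    (is "realization ?L' homeomorphic realization ?L")
proof -
  define \<mu> :: "('a \<Rightarrow> real) \<Rightarrow> real" where "\<mu> f = min (f a) (min (f b) (f c))" for f
  define \<Phi> :: "('a \<Rightarrow> real) \<Rightarrow> 'a \<Rightarrow> real" where
    "\<Phi> f = (\<lambda>x. if x = d then 3 * \<mu> f else if x = a \<or> x = b \<or> x = c then f x - \<mu> f else f x)" for f
  define \<Psi> :: "('a \<Rightarrow> real) \<Rightarrow> 'a \<Rightarrow> real" where
    "\<Psi> g = (\<lambda>x. if x = d then 0 else if x = a \<or> x = b \<or> x = c then g x + g d / 3 else g x)" for g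
  have fin: "finite t" if "t \<in> L" for t using card3[OF that] card.infinite by fastforce
  \<comment> \<open>No triangle of \<open>L\<close> contains \<open>d\<close> or all of
    \<open>a\<close>, \<open>b\<close>, \<open>c\<close>, so both maps are the identity on
    \<open>L\<close> and agree there with their formulas on the changed triangles.\<close>
  have old: "f d = 0" "\<mu> f = 0" if "t \<in> L" "f \<in> realization {t}" for f t
  proof -
    show "f d = 0" using that d by (auto simp: mem_realization_single)
    have "\<not> {a, b, c} \<subseteq> t"
    proof
      assume "{a, b, c} \<subseteq> t"
      then have "{a, b, c} = t" using card3[OF that(1)] fin[OF that(1)] ne by (intro card_subset_eq) auto
      then show False using d that by simp
    qed
    then have "f a = 0 \<or> f b = 0 \<or> f c = 0" using that by (auto simp: mem_realization_single)
    moreover have "0 \<le> f a" "0 \<le> f b" "0 \<le> f c" using that by (auto simp: mem_realization_single)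
    ultimately show "\<mu> f = 0" by (auto simp: \<mu>_def min_def)
  qed
  have old\<Phi>: "\<Phi> f = f" and old\<Psi>: "\<Psi> f = f" if "t \<in> L" "f \<in> realization {t}" for f t
    using old[OF that] by (auto simp: \<Phi>_def \<Psi>_def)
  have L'_cases: "(\<exists>t\<in>L. g \<in> realization {t}) \<or>
      (\<forall>x. x \<notin> {a, b, c, d} \<longrightarrow> g x = 0) \<and> (\<forall>x. 0 \<le> g x) \<and> g a + g b + g c + g d = 1 \<and> (g a = 0 \<or> g b = 0 \<or> g c = 0)"
    if "g \<in> realization ?L'" for g
    using that ne by (subst (asm) realization_eq_UN) (auto simp: mem_realization_single)
  have L'_new: "g \<in> realization ?L'" if "\<forall>x. x \<notin> {a, b, c, d} \<longrightarrow> g x = 0" "\<forall>x. 0 \<le> g x"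
    "g a + g b + g c + g d = 1" "g a = 0 \<or> g b = 0 \<or> g c = 0" for g
  proof -
    have "g \<in> realization {{a, b, d}} \<or> g \<in> realization {{b, c, d}} \<or> g \<in> realization {{a, c, d}}"
      using that ne by (auto simp: mem_realization_single)
    then show ?thesis by (subst realization_eq_UN) blast
  qed
  have L_cases: "(\<exists>t\<in>L. f \<in> realization {t}) \<or> f \<in> realization {{a, b, c}}" if "f \<in> realization ?L" for f
    using that by (subst (asm) realization_eq_UN) blast
  have "homeomorphism (realization ?L') (realization ?L) \<Psi> \<Phi>"
  proof (rule homeomorphismI)
    have co: "continuous_on A (\<lambda>f::'a \<Rightarrow> real. f x)" for A x
      by (rule continuous_on_subset[OF continuous_on_product_coordinates]) simp
    show "continuous_on (realization ?L') \<Psi>"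
    proof (rule continuous_on_coordinatewise_then_product)
      fix i show "continuous_on (realization ?L') (\<lambda>f. \<Psi> f i)"
        unfolding \<Psi>_def by (cases "i = d"; cases "i = a \<or> i = b \<or> i = c") (auto intro!: continuous_intros co)
    qed
    have \<mu>: "continuous_on A \<mu>" for A unfolding \<mu>_def by (intro continuous_intros co)
    show "continuous_on (realization ?L) \<Phi>"
    proof (rule continuous_on_coordinatewise_then_product)
      fix i show "continuous_on (realization ?L) (\<lambda>f. \<Phi> f i)"
        unfolding \<Phi>_def by (cases "i = d"; cases "i = a \<or> i = b \<or> i = c") (auto intro!: continuous_intros co \<mu>)
    qed
    show "\<Psi> ` realization ?L' \<subseteq> realization ?L"
    proof clarify
      fix g assume "g \<in> realization ?L'"
      from L'_cases[OF this] show "\<Psi> g \<in> realization ?L"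
      proof
        assume "\<exists>t\<in>L. g \<in> realization {t}"
        then obtain t where t: "t \<in> L" "g \<in> realization {t}" by blast
        then show ?thesis unfolding old\<Psi>[OF t] by (subst realization_eq_UN) blast
      next
        assume "(\<forall>x. x \<notin> {a, b, c, d} \<longrightarrow> g x = 0) \<and> (\<forall>x. 0 \<le> g x) \<and> g a + g b + g c + g d = 1 \<and> (g a = 0 \<or> g b = 0 \<or> g c = 0)"
        then have "\<Psi> g \<in> realization {{a, b, c}}"
          using ne by (auto simp: mem_realization_single \<Psi>_def)
        then show ?thesis by (subst realization_eq_UN) blast
      qed
    qed
    show "\<Phi> ` realization ?L \<subseteq> realization ?L'"
    proof clarify
      fix f assume "f \<in> realization ?L"
      from L_cases[OF this] show "\<Phi> f \<in> realization ?L'"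
      proof
        assume "\<exists>t\<in>L. f \<in> realization {t}"
        then obtain t where t: "t \<in> L" "f \<in> realization {t}" by blast
        then show ?thesis unfolding old\<Phi>[OF t] by (subst realization_eq_UN) blast
      next
        assume f: "f \<in> realization {{a, b, c}}"
        have \<mu>: "0 \<le> \<mu> f" "\<mu> f \<le> f a" "\<mu> f \<le> f b" "\<mu> f \<le> f c" "\<mu> f = f a \<or> \<mu> f = f b \<or> \<mu> f = f c"
          using f by (auto simp: mem_realization_single \<mu>_def min_def)
        have 1: "f a + f b + f c = 1" "\<And>x. x \<noteq> a \<Longrightarrow> x \<noteq> b \<Longrightarrow> x \<noteq> c \<Longrightarrow> f x = 0" "\<And>x. 0 \<le> f x"
          using f ne by (auto simp: mem_realization_single)
        show ?thesis by (rule L'_new) (use \<mu> 1 ne in \<open>auto simp: \<Phi>_def\<close>)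
      qed
    qed
    show "\<Phi> (\<Psi> g) = g" if "g \<in> realization ?L'" for g
      using L'_cases[OF that]
    proof
      assume "\<exists>t\<in>L. g \<in> realization {t}"
      then obtain t where t: "t \<in> L" "g \<in> realization {t}" by blast
      then show ?thesis by (simp add: old\<Phi>[OF t] old\<Psi>[OF t])
    next
      assume g: "(\<forall>x. x \<notin> {a, b, c, d} \<longrightarrow> g x = 0) \<and> (\<forall>x. 0 \<le> g x) \<and> g a + g b + g c + g d = 1 \<and> (g a = 0 \<or> g b = 0 \<or> g c = 0)"
      have "\<mu> (\<Psi> g) = min (g a) (min (g b) (g c)) + g d / 3"
        using ne by (auto simp: \<mu>_def \<Psi>_def min_def)
      moreover have "min (g a) (min (g b) (g c)) = 0"
        using g by (auto simp: min_def intro: antisym)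
      ultimately have "\<mu> (\<Psi> g) = g d / 3" by simp
      then show ?thesis using ne by (auto simp: \<Phi>_def \<Psi>_def)
    qed
    show "\<Psi> (\<Phi> f) = f" if "f \<in> realization ?L" for f
    proof -
      have "f d = 0" using L_cases[OF that] old ne by (auto simp: mem_realization_single)
      then show ?thesis using ne by (auto simp: \<Phi>_def \<Psi>_def)
    qed
  qed
  then show ?thesis unfolding homeomorphic_def by blast
qed

text \<open>Each triangle is the complement of one vertex, and distinct vertices have distinct
  complements.\<close>

lemma card_tetrahedron_boundary:
  assumes ne: "distinct [a, b, c, d]"
  shows "card {{a, b, c}, {a, b, d}, {a, c, d}, {b, c, d}} = 4" "card {{a, b, d}, {b, c, d}, {a, c, d}} = 3"
proof -
  let ?f = "\<lambda>x. {a, b, c, d} - {x}"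
  have f: "?f a = {b, c, d}" "?f b = {a, c, d}" "?f c = {a, b, d}" "?f d = {a, b, c}" using ne by auto
  have inj: "inj_on ?f {a, b, c, d}" unfolding inj_on_def by blast
  have "card (?f ` {d, c, b, a}) = card {d, c, b, a}" "card (?f ` {c, a, b}) = card {c, a, b}"
    by (rule card_image, rule inj_on_subset[OF inj], blast)+
  then show "card {{a, b, c}, {a, b, d}, {a, c, d}, {b, c, d}} = 4" "card {{a, b, d}, {b, c, d}, {a, c, d}} = 3"
    using ne unfolding image_insert f by auto
qed

text \<open>A cone from \<open>w 1\<close> over the path \<open>w 2, ..., w M\<close>, glued to a
  cone from \<open>p\<close> over the path \<open>w 1, ..., w M\<close>: a disc bounded by the three
  edges of \<open>{w 1, w M, p}\<close>. Adding this triangle gives the shape of the vertex links of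
  cyclic polytopes.\<close>

definition fan :: "(nat \<Rightarrow> 'v) \<Rightarrow> 'v \<Rightarrow> nat \<Rightarrow> 'v set set" where
  "fan w p M = {{w 1, w j, w (Suc j)} | j. 2 \<le> j \<and> j < M} \<union> {{w j, w (Suc j), p} | j. 1 \<le> j \<and> j < M}"

lemma fan_3: "fan w p 3 = {{w 1, w 2, w 3}, {w 1, w 2, p}, {w 2, w 3, p}}"
proof -
  have "2 \<le> j \<and> j < 3 \<longleftrightarrow> j = 2" "1 \<le> j \<and> j < 3 \<longleftrightarrow> j = 1 \<or> j = 2" for j :: nat by auto
  then show ?thesis by (auto simp: fan_def numeral_3_eq_3 numeral_2_eq_2)
qed

lemma fan_Suc:
  assumes "3 \<le> M"
  shows "fan w p (Suc M) = {{w 1, w M, w (Suc M)}, {w M, w (Suc M), p}} \<union> fan w p M"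
  using assms unfolding fan_def by (auto simp: less_Suc_eq)

text \<open>Going from \<open>M\<close> to \<open>Suc M\<close> is the stellar subdivision of the closing triangle
\<open>{w 1, w M, p}\<close> by the new vertex \<open>w (Suc M)\<close>.\<close>

lemma fan_sphere:
  assumes "3 \<le> M" "inj_on w {1..M}" "p \<notin> w ` {1..M}"
  shows "comb_2_sphere (insert {w 1, w M, p} (fan w p M)) \<and> card (insert {w 1, w M, p} (fan w p M)) = 2 * M - 2"
  using assms
proof (induction M rule: dec_induct)
  case base
  have "distinct [w 1, w 2, w 3, p]"
    using inj_on_eq_iff[OF base.prems(1), of 1 2] inj_on_eq_iff[OF base.prems(1), of 1 3]
      inj_on_eq_iff[OF base.prems(1), of 2 3] base.prems(2) by force
  then have d: "w 1 \<noteq> w 2" "w 1 \<noteq> w 3" "w 2 \<noteq> w 3" "w 1 \<noteq> p" "w 2 \<noteq> p" "w 3 \<noteq> p" by auto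
  have eq: "insert {w 1, w 3, p} (fan w p 3) = {{w 1, w 2, w 3}, {w 1, w 2, p}, {w 1, w 3, p}, {w 2, w 3, p}}"
    unfolding fan_3 by blast
  have "card {{w 1, w 2, w 3}, {w 1, w 2, p}, {w 1, w 3, p}, {w 2, w 3, p}} = 4"
    by (rule card_tetrahedron_boundary(1)) fact
  then show ?case
    unfolding eq comb_2_sphere_def
    using tetrahedron_boundary_homeomorphic_sphere[OF \<open>distinct [w 1, w 2, w 3, p]\<close>] d by simp
next
  case (step M)
  have inj: "inj_on w {1..M}" "p \<notin> w ` {1..M}" using step.prems by (auto simp: inj_on_def)
  let ?L = "fan w p M"
  have IH: "comb_2_sphere (insert {w 1, w M, p} ?L)" "card (insert {w 1, w M, p} ?L) = 2 * M - 2"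
    using step.IH inj by auto
  have w: "w i = w j \<longleftrightarrow> i = j" if "1 \<le> i" "i \<le> Suc M" "1 \<le> j" "j \<le> Suc M" for i j
    using step.prems(1) that by (auto simp: inj_on_def)
  have wp: "w i \<noteq> p" if "1 \<le> i" "i \<le> Suc M" for i using step.prems(2) that by auto
  have ne: "distinct [w 1, w M, p, w (Suc M)]"
    using w[of 1 M] w[of 1 "Suc M"] w[of M "Suc M"] wp[of 1] wp[of M] wp[of "Suc M"] step.hyps by auto
  have new: "w (Suc M) \<notin> \<Union>?L"
  proof
    assume "w (Suc M) \<in> \<Union>?L"
    then consider j where "2 \<le> j" "j < M" "w (Suc M) \<in> {w 1, w j, w (Suc j)}"
      | j where "1 \<le> j" "j < M" "w (Suc M) \<in> {w j, w (Suc j), p}" unfolding fan_def by blast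
    then show False
    proof cases
      case (1 j)
      then show False using w[of "Suc M" 1] w[of "Suc M" j] w[of "Suc M" "Suc j"] by auto
    next
      case (2 j)
      then show False using w[of "Suc M" j] w[of "Suc M" "Suc j"] wp[of "Suc M"] by auto
    qed
  qed
  \<comment> \<open>The closing triangle must not occur in the fan, since the subdivision is to
    remove it entirely. This also makes the count exact: one triangle goes and three come.\<close>
  have T: "{w 1, w M, p} \<notin> ?L"
  proof
    assume "{w 1, w M, p} \<in> ?L"
    then consider j where "2 \<le> j" "j < M" "{w 1, w M, p} = {w 1, w j, w (Suc j)}"
      | j where "1 \<le> j" "j < M" "{w 1, w M, p} = {w j, w (Suc j), p}" unfolding fan_def by blast
    then show False
    proof cases
      case 1
      then have "p \<in> {w 1, w j, w (Suc j)}" by auto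
      then show False using 1 wp[of 1] wp[of j] wp[of "Suc j"] by auto
    next
      case 2
      then have "w 1 \<in> {w j, w (Suc j), p}" "w M \<in> {w j, w (Suc j), p}" by auto
      then have "j = 1" "Suc j = M"
        using 2 w[of 1 j] w[of 1 "Suc j"] w[of M j] w[of M "Suc j"] wp[of 1] wp[of M] by auto
      then show False using step.hyps by simp
    qed
  qed
  have eq: "insert {w 1, w (Suc M), p} (fan w p (Suc M))
      = {{w 1, w M, w (Suc M)}, {w M, p, w (Suc M)}, {w 1, p, w (Suc M)}} \<union> ?L"
    unfolding fan_Suc[OF step.hyps(1)] by (auto simp: insert_commute)
  have L: "finite ?L" "\<And>t. t \<in> ?L \<Longrightarrow> card t = 3"
    using IH(1) by (auto simp: comb_2_sphere_def)
  have "realization ({{w 1, w M, w (Suc M)}, {w M, p, w (Suc M)}, {w 1, p, w (Suc M)}} \<union> ?L)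
      homeomorphic realization (insert {w 1, w M, p} ?L)"
    by (rule stellar_subdivision_homeomorphic[OF L(2) ne new T])
  then have "realization (insert {w 1, w (Suc M), p} (fan w p (Suc M))) homeomorphic sphere (0::real^3) 1"
    unfolding eq using IH(1) homeomorphic_trans unfolding comb_2_sphere_def by blast
  moreover have "\<forall>t\<in>insert {w 1, w (Suc M), p} (fan w p (Suc M)). card t = 3"
    unfolding eq using L(2) ne by auto
  moreover have "card (insert {w 1, w (Suc M), p} (fan w p (Suc M))) = 2 * Suc M - 2"
  proof -
    have "card ({{w 1, w M, w (Suc M)}, {w M, p, w (Suc M)}, {w 1, p, w (Suc M)}} \<union> ?L)
       = card {{w 1, w M, w (Suc M)}, {w M, p, w (Suc M)}, {w 1, p, w (Suc M)}} + card ?L"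
      using L(1) new by (intro card_Un_disjoint) auto
    moreover have "card {{w 1, w M, w (Suc M)}, {w M, p, w (Suc M)}, {w 1, p, w (Suc M)}} = 3"
      by (rule card_tetrahedron_boundary(2)[OF ne])
    moreover have "card ?L + 1 = 2 * M - 2" using IH(2) T L(1) by simp
    ultimately show ?thesis unfolding eq by simp
  qed
  ultimately show ?case unfolding comb_2_sphere_def using L(1) unfolding eq by auto
qed

section \<open>Boundaries of cyclic polytopes\<close>

text \<open>Gale's evenness condition: the facets of the boundary of the cyclic 4-polytope with \<open>n\<close>
vertices are the unions of two disjoint edges of the \<open>n\<close>-cycle.\<close>

definition cyc_edge :: "nat \<Rightarrow> nat \<Rightarrow> nat set" where
  "cyc_edge n i = {i mod n, Suc i mod n}"

definition cyclic_sphere :: "nat \<Rightarrow> nat set set" where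
  "cyclic_sphere n = {cyc_edge n i \<union> cyc_edge n j | i j. card (cyc_edge n i \<union> cyc_edge n j) = 4}"

lemma inj_on_rotation: "inj_on (\<lambda>s. (v + s) mod n) {..<n}" for n v :: nat
proof (rule linorder_inj_onI)
  fix x y :: nat assume xy: "x < y" "x \<in> {..<n}" "y \<in> {..<n}"
  show "(v + x) mod n \<noteq> (v + y) mod n"
  proof
    assume "(v + x) mod n = (v + y) mod n"
    then have "n dvd (v + y) - (v + x)" using xy by (subst mod_eq_dvd_iff_nat[symmetric]) auto
    then show False using xy by (auto dest: dvd_imp_le)
  qed
qed auto

text \<open>Positions on the cycle are measured from \<open>v\<close>, so that the edges at
  \<open>v\<close> are those with \<open>r = 0\<close> and \<open>r = n - 1\<close>.\<close>

lemma cyc_edge_rotation: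
  assumes "v < n"
  shows "\<exists>r<n. cyc_edge n i = {(v + r) mod n, (v + Suc r) mod n}"
proof (intro exI conjI)
  \<comment> \<open>This is \<open>i - v\<close> modulo \<open>n\<close>, with \<open>n - v\<close>
    added in place of a subtraction that could truncate.\<close>
  let ?r = "(i + (n - v)) mod n"
  show "?r < n" using assms by simp
  have *: "(v + ?r) mod n = i mod n"
  proof -
    have "(v + ?r) mod n = (v + (i + (n - v))) mod n" by (simp add: mod_add_right_eq)
    also have "v + (i + (n - v)) = i + n" using assms by simp
    finally show ?thesis by simp
  qed
  have "(v + Suc ?r) mod n = Suc ((v + ?r) mod n) mod n" by (simp add: mod_Suc_eq)
  also have "\<dots> = Suc i mod n" unfolding * by (simp add: mod_Suc_eq)
  finally show "cyc_edge n i = {(v + ?r) mod n, (v + Suc ?r) mod n}"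
    using * by (simp add: cyc_edge_def)
qed

text \<open>A facet at \<open>v\<close> uses one of the two cycle edges at \<open>v\<close>. If it
  is \<open>{v, w 1}\<close>, removing \<open>v\<close> leaves \<open>w 1\<close> with an edge of
  the path \<open>w 2, ..., w (n - 1)\<close>; if it is \<open>{w (n - 1), v}\<close>, it leaves
  \<open>w (n - 1)\<close> with an edge of \<open>w 1, ..., w (n - 2)\<close>. These are the two
  cones of the fan with apex \<open>p = w (n - 1)\<close>.\<close>

lemma vlink_cyclic_sphere:
  assumes n: "5 \<le> n" and v: "v < n"
  defines "w \<equiv> \<lambda>s. (v + s) mod n"
  shows "vlink (cyclic_sphere n) v = insert {w 1, w (n - 2), w (n - 1)} (fan w (w (n - 1)) (n - 2))"
proof -
  have w0: "w 0 = v" and wn: "w n = v" using v by (auto simp: w_def)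
  have w: "w i = w j \<longleftrightarrow> i = j" if "i < n" "j < n" for i j
    using inj_on_eq_iff[OF inj_on_rotation[of v n], of i j] that by (simp add: w_def)
  have wv: "w i = v \<longleftrightarrow> i = 0" "v = w i \<longleftrightarrow> i = 0" if "i < n" for i using w[of i 0] w0 that n by auto
  have edge: "cyc_edge n (v + s) = {w s, w (Suc s)}" for s by (simp add: cyc_edge_def w_def)
  have last: "Suc (n - Suc 0) = n" using n by simp
  show ?thesis
  proof (intro equalityI subsetI)
    fix \<tau> assume "\<tau> \<in> vlink (cyclic_sphere n) v"
    then obtain t where t: "t \<in> cyclic_sphere n" "v \<in> t" "\<tau> = t - {v}" by (auto simp: vlink_def)
    then obtain i0 j0 where 0: "t = cyc_edge n i0 \<union> cyc_edge n j0" "card t = 4"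
      unfolding cyclic_sphere_def by blast
    then have "v \<in> cyc_edge n i0 \<or> v \<in> cyc_edge n j0" using t(2) by blast
    then obtain i j where ij: "t = cyc_edge n i \<union> cyc_edge n j" "card t = 4" "v \<in> cyc_edge n i"
      using 0 by (metis Un_commute)
    obtain r s where rs: "r < n" "s < n" "cyc_edge n i = {w r, w (Suc r)}" "cyc_edge n j = {w s, w (Suc s)}"
      using cyc_edge_rotation[OF v] unfolding w_def by metis
    have t_eq: "t = {w r, w (Suc r), w s, w (Suc s)}" using ij rs by auto
    have dist: "distinct [w r, w (Suc r), w s, w (Suc s)]"
      using ij(2) unfolding t_eq by (intro card_distinct) simp
    have "r = 0 \<or> Suc r = n"
    proof (rule ccontr)
      assume a: "\<not> (r = 0 \<or> Suc r = n)"
      then have "w r \<noteq> v" "w (Suc r) \<noteq> v" using wv(1)[of r] wv(1)[of "Suc r"] rs(1) by auto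
      then show False using ij(3) rs(3) by auto
    qed
    then show "\<tau> \<in> insert {w 1, w (n - 2), w (n - 1)} (fan w (w (n - 1)) (n - 2))"
    proof
      assume r: "r = 0"
      have s: "s \<noteq> 0" "s \<noteq> 1" "Suc s \<noteq> n"
        by (rule notI; use dist r w0 wn in auto)+
      have "\<tau> = {w 1, w s, w (Suc s)}" using t(3) t_eq dist r w0 by auto
      \<comment> \<open>The last value \<open>s = n - 2\<close> lies outside the index range of the
        fan and yields the closing triangle.\<close>
      moreover have "2 \<le> s" "s < n - 2 \<or> s = n - 2" using s rs(2) by auto
      moreover have "Suc (n - 2) = n - 1" using n by simp
      ultimately show ?thesis unfolding fan_def by auto
    next
      assume r: "Suc r = n"
      have s: "Suc s \<noteq> n" "s \<noteq> 0" "Suc s \<noteq> r"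
        by (rule notI; use dist r w0 wn in auto)+
      have "\<tau> = {w s, w (Suc s), w (n - 1)}" using t(3) t_eq dist r w0 wn by auto
      moreover have "1 \<le> s" "s < n - 2" using s rs(2) r by auto
      ultimately show ?thesis unfolding fan_def by auto
    qed
  next
    have first: "{w 1, w s, w (Suc s)} \<in> vlink (cyclic_sphere n) v" if "2 \<le> s" "Suc s < n" for s
    proof -
      let ?t = "{w 0, w 1, w s, w (Suc s)}"
      have "distinct [w 0, w 1, w s, w (Suc s)]"
        using that w[of 0 1] w[of 0 s] w[of 0 "Suc s"] w[of 1 s] w[of 1 "Suc s"] w[of s "Suc s"] by auto
      then have c: "card ?t = 4" "?t - {v} = {w 1, w s, w (Suc s)}" using w0 by auto
      moreover have "?t = cyc_edge n (v + 0) \<union> cyc_edge n (v + s)" unfolding edge by auto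
      ultimately have "?t \<in> cyclic_sphere n" unfolding cyclic_sphere_def by force
      then have "?t - {v} \<in> vlink (cyclic_sphere n) v" using w0 unfolding vlink_def by blast
      then show ?thesis using c by simp
    qed
    have second: "{w s, w (Suc s), w (n - 1)} \<in> vlink (cyclic_sphere n) v" if "1 \<le> s" "s < n - 2" for s
    proof -
      let ?t = "{w (n - 1), w 0, w s, w (Suc s)}"
      have "n - 1 < n" "0 < n" "s < n" "Suc s < n" "n - 1 \<noteq> 0" "n - 1 \<noteq> s" "n - 1 \<noteq> Suc s" "0 \<noteq> s"
        using that by auto
      then have "distinct [w (n - 1), w 0, w s, w (Suc s)]" by (simp add: w)
      then have c: "card ?t = 4" "?t - {v} = {w s, w (Suc s), w (n - 1)}" using w0 by auto
      have "?t = cyc_edge n (v + (n - 1)) \<union> cyc_edge n (v + s)"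
        unfolding edge using w0 wn last by auto
      then have "?t \<in> cyclic_sphere n" using c(1) unfolding cyclic_sphere_def by force
      then have "?t - {v} \<in> vlink (cyclic_sphere n) v" using w0 unfolding vlink_def by blast
      then show ?thesis using c by simp
    qed
    fix \<tau> assume "\<tau> \<in> insert {w 1, w (n - 2), w (n - 1)} (fan w (w (n - 1)) (n - 2))"
    then consider "\<tau> = {w 1, w (n - 2), w (n - 1)}"
      | s where "2 \<le> s" "s < n - 2" "\<tau> = {w 1, w s, w (Suc s)}"
      | s where "1 \<le> s" "s < n - 2" "\<tau> = {w s, w (Suc s), w (n - 1)}"
      unfolding fan_def by blast
    then show "\<tau> \<in> vlink (cyclic_sphere n) v"
    proof cases
      case 1
      have "Suc (n - 2) = n - 1" using n by simp
      then show ?thesis using first[of "n - 2"] n 1 by simp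
    next
      case (2 s)
      then show ?thesis using first[of s] by simp
    qed (use second in simp)
  qed
qed

text \<open>Each link is extremal: n - 1 vertices and 2 (n - 1) - 4 triangles. That all other
  vertices occur in it is 2-neighborliness seen from \<open>v\<close>.\<close>

lemma vlink_cyclic_sphere_sphere:
  assumes n: "5 \<le> n" and v: "v < n"
  shows "comb_2_sphere (vlink (cyclic_sphere n) v)" "card (vlink (cyclic_sphere n) v) = 2 * n - 6"
    "vertices (vlink (cyclic_sphere n) v) = {..<n} - {v}"
proof -
  define w where "w = (\<lambda>s. (v + s) mod n)"
  have link: "vlink (cyclic_sphere n) v = insert {w 1, w (n - 2), w (n - 1)} (fan w (w (n - 1)) (n - 2))"
    unfolding w_def by (rule vlink_cyclic_sphere[OF n v])
  have injw: "inj_on w {..<n}" unfolding w_def by (rule inj_on_rotation)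
  have "inj_on w {1..n - 2}" by (rule inj_on_subset[OF injw]) (use n in auto)
  moreover have "w (n - 1) \<notin> w ` {1..n - 2}"
  proof
    assume "w (n - 1) \<in> w ` {1..n - 2}"
    then obtain i where i: "i \<in> {1..n - 2}" "w (n - 1) = w i" by blast
    have "i < n" "n - 1 < n" using i(1) n by auto
    then have "n - 1 = i" using inj_on_eq_iff[OF injw, of "n - 1" i] i(2) by simp
    then show False using i(1) n by auto
  qed
  ultimately show "comb_2_sphere (vlink (cyclic_sphere n) v)" "card (vlink (cyclic_sphere n) v) = 2 * n - 6"
    using fan_sphere[of "n - 2" w "w (n - 1)"] n unfolding link by auto
  have wim: "w ` {..<n} = {..<n}"
    using injw n by (intro endo_inj_surj) (auto simp: w_def)
  have "w 0 = v" using v by (simp add: w_def)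
  have "{..<n} - {v} = w ` ({..<n} - {0})"
    using inj_on_image_set_diff[OF injw, of "{..<n}" "{0}"] wim \<open>w 0 = v\<close> n by auto
  also have "{..<n} - {0} = {1..n - 1}" using n by auto
  finally have rng: "{..<n} - {v} = w ` {1..n - 1}" .
  have "\<Union>(fan w (w (n - 1)) (n - 2)) \<subseteq> w ` {1..n - 1}"
    using n unfolding fan_def by auto
  moreover have "w s \<in> vertices (vlink (cyclic_sphere n) v)" if s: "s \<in> {1..n - 1}" for s
  proof -
    consider "s = n - 1" | "s = n - 2" | "1 \<le> s" "s < n - 2" using s by fastforce
    then show ?thesis
    proof cases
      case 3
      then have "{w s, w (Suc s), w (n - 1)} \<in> fan w (w (n - 1)) (n - 2)" unfolding fan_def by blast
      then show ?thesis unfolding link vertices_def by blast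
    qed (auto simp: link vertices_def)
  qed
  moreover have "{w 1, w (n - 2), w (n - 1)} \<subseteq> w ` {1..n - 1}" using n by (auto intro!: imageI)
  moreover have "vertices (vlink (cyclic_sphere n) v)
      = {w 1, w (n - 2), w (n - 1)} \<union> \<Union>(fan w (w (n - 1)) (n - 2))"
    unfolding link vertices_def by (rule Union_insert)
  ultimately show "vertices (vlink (cyclic_sphere n) v) = {..<n} - {v}"
    unfolding rng by (intro equalityI image_subsetI) (simp_all only: Un_subset_iff simp_thms)
qed

lemma vertices_cyclic_sphere:
  assumes "5 \<le> n" shows "vertices (cyclic_sphere n) = {..<n}"
proof
  show "vertices (cyclic_sphere n) \<subseteq> {..<n}"
    using assms by (auto simp: vertices_def cyclic_sphere_def cyc_edge_def)
  show "{..<n} \<subseteq> vertices (cyclic_sphere n)"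
  proof
    fix v assume "v \<in> {..<n}"
    then have "vlink (cyclic_sphere n) v \<noteq> {}"
      using vlink_cyclic_sphere_sphere(1)[OF assms] by (simp add: comb_2_sphere_def)
    then show "v \<in> vertices (cyclic_sphere n)" by (auto simp: vlink_def vertices_def)
  qed
qed

lemma cyclic_sphere_manifold:
  assumes n: "5 \<le> n" shows "comb_3_manifold (cyclic_sphere n)"
  unfolding comb_3_manifold_def
proof (intro conjI ballI)
  have "cyclic_sphere n \<subseteq> Pow {..<n}" using vertices_cyclic_sphere[OF n] by (auto simp: vertices_def)
  then show "finite (cyclic_sphere n)" by (meson finite_Pow_iff finite_lessThan finite_subset)
  have "vertices (cyclic_sphere n) \<noteq> {}" using vertices_cyclic_sphere[OF n] n by (simp add: lessThan_empty_iff)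
  then show "cyclic_sphere n \<noteq> {}" by (auto simp: vertices_def)
  fix t assume "t \<in> cyclic_sphere n"
  then show "finite t" "card t = 4" by (auto simp: cyclic_sphere_def cyc_edge_def)
next
  fix v assume "v \<in> vertices (cyclic_sphere n)"
  then show "comb_2_sphere (vlink (cyclic_sphere n) v)"
    using vlink_cyclic_sphere_sphere(1)[OF n] vertices_cyclic_sphere[OF n] by simp
qed

lemma cyclic_sphere_neighborly:
  assumes n: "5 \<le> n" shows "two_neighborly (cyclic_sphere n)"
  unfolding two_neighborly_def
proof (intro ballI impI)
  fix v u assume "v \<in> vertices (cyclic_sphere n)" "u \<in> vertices (cyclic_sphere n)" "v \<noteq> u"
  then have "v < n" "u \<in> {..<n} - {v}" using vertices_cyclic_sphere[OF n] by auto
  then have "u \<in> vertices (vlink (cyclic_sphere n) v)" using vlink_cyclic_sphere_sphere(3)[OF n] by blast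
  then show "{v, u} \<in> faces (cyclic_sphere n)" by (auto simp: vertices_def vlink_def faces_def)
qed

lemma card_cyclic_sphere:
  assumes n: "5 \<le> n" shows "2 * card (cyclic_sphere n) = n * (n - 3)"
proof -
  have "(\<Sum>v\<in>vertices (cyclic_sphere n). card (vlink (cyclic_sphere n) v)) = n * (2 * n - 6)"
    unfolding vertices_cyclic_sphere[OF n] using vlink_cyclic_sphere_sphere(2)[OF n] by simp
  then have "4 * card (cyclic_sphere n) = n * (2 * (n - 3))"
    using sum_card_vlink[OF cyclic_sphere_manifold[OF n]] by (simp add: diff_mult_distrib2)
  then show ?thesis by simp
qed

lemma cyclic_sphere_facet_parity:
  assumes t: "t \<in> cyclic_sphere (2 * k)" and k: "3 \<le> k"
  shows "card (t \<inter> {i. i < 2 * k \<and> even i}) = 2" "card (t \<inter> {i. i < 2 * k \<and> odd i}) = 2"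
proof -
  let ?n = "2 * k"
  have e: "\<exists>x y. cyc_edge ?n i = {x, y} \<and> even x \<and> odd y \<and> x < ?n \<and> y < ?n" for i
  proof -
    \<comment> \<open>The modulus is even, so reduction preserves parity, and the edge that wraps
      around the cycle also joins an even vertex to an odd one.\<close>
    have par: "even (j mod ?n) \<longleftrightarrow> even j" for j by (simp add: dvd_mod_iff)
    have lt: "j mod ?n < ?n" for j using k by simp
    show ?thesis
    proof (cases "even i")
      case True
      then show ?thesis using par lt unfolding cyc_edge_def
        by (intro exI[of _ "i mod ?n"] exI[of _ "Suc i mod ?n"]) simp
    next
      case False
      then show ?thesis using par lt unfolding cyc_edge_def
        by (intro exI[of _ "Suc i mod ?n"] exI[of _ "i mod ?n"]) (simp add: insert_commute)
    qed
  qed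
  obtain i j where t: "t = cyc_edge ?n i \<union> cyc_edge ?n j" "card t = 4" using t by (auto simp: cyclic_sphere_def)
  obtain x y where xy: "cyc_edge ?n i = {x, y}" "even x" "odd y" "x < ?n" "y < ?n" using e by blast
  obtain x' y' where xy': "cyc_edge ?n j = {x', y'}" "even x'" "odd y'" "x' < ?n" "y' < ?n" using e by blast
  have "t = {x, y, x', y'}" using t xy xy' by auto
  then have d: "distinct [x, y, x', y']" using t(2) by (intro card_distinct) simp
  have "t \<inter> {i. i < ?n \<and> even i} = {x, x'}" "t \<inter> {i. i < ?n \<and> odd i} = {y, y'}"
    unfolding \<open>t = {x, y, x', y'}\<close> using xy xy' by auto
  then show "card (t \<inter> {i. i < ?n \<and> even i}) = 2" "card (t \<inter> {i. i < ?n \<and> odd i}) = 2" using d by auto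
qed

lemma card_parity_classes:
  "card {i. i < 2 * k \<and> even i} = k" "card {i. i < 2 * k \<and> odd i} = k" for k :: nat
proof -
  have "{i. i < 2 * k \<and> even i} = (\<lambda>i. 2 * i) ` {..<k}" by (auto elim!: evenE)
  then show "card {i. i < 2 * k \<and> even i} = k" by (simp add: card_image inj_on_def)
  have "{i. i < 2 * k \<and> odd i} = (\<lambda>i. 2 * i + 1) ` {..<k}" by (auto elim!: oddE)
  then show "card {i. i < 2 * k \<and> odd i} = k" by (simp add: card_image inj_on_def)
qed

text \<open>All k (2 k - 3) tetrahedra yield quadrilaterals, so q equals the number of bichromatic
  tetrahedra and q + 2 chi = 2 k^2 - q. Hence chi = k^2 - k (2 k - 3) = 3 k - k^2, and 2 g = 2 - chi
  = (k - 1) (k - 2).\<close>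

lemma cyclic_sphere_slicing:
  assumes k: "3 \<le> k"
  defines "V1 \<equiv> {i. i < 2 * k \<and> even i}" and "V2 \<equiv> {i. i < 2 * k \<and> odd i}"
  shows "is_partition (cyclic_sphere (2 * k)) V1 V2"
    "slicing_genus (cyclic_sphere (2 * k)) V1 V2 = real ((k - 1) choose 2)"
    "real (slicing_quads (cyclic_sphere (2 * k)) V1 V2)
      = 4 * slicing_genus (cyclic_sphere (2 * k)) V1 V2 + 3 * real k - 4"
proof -
  let ?K = "cyclic_sphere (2 * k)"
  have n: "5 \<le> 2 * k" using k by simp
  note K = cyclic_sphere_manifold[OF n] and N = cyclic_sphere_neighborly[OF n]
  have c: "card V1 = k" "card V2 = k" unfolding V1_def V2_def by (rule card_parity_classes)+
  then have "V1 \<noteq> {}" "V2 \<noteq> {}" using k by auto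
  then show P: "is_partition ?K V1 V2"
    unfolding is_partition_def vertices_cyclic_sphere[OF n] by (auto simp: V1_def V2_def)
  have par: "card (t \<inter> V1) = 2" "card (t \<inter> V2) = 2" if "t \<in> ?K" for t
    unfolding V1_def V2_def using cyclic_sphere_facet_parity[OF that k] by auto
  have "{t \<in> ?K. card (t \<inter> V1) = 2 \<and> card (t \<inter> V2) = 2} = ?K" using par by auto
  then have q: "slicing_quads ?K V1 V2 = card ?K" unfolding slicing_quads_def by simp
  have "{t \<in> ?K. t \<inter> V1 \<noteq> {} \<and> t \<inter> V2 \<noteq> {}} = ?K" using par by force
  then have "bichromatic ?K V1 V2 4 = ?K" unfolding bichromatic_4[OF K P] .
  then have chi: "slicing_euler_char ?K V1 V2 = int k * int k - int (card ?K)"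
    using slicing_quads_plus_euler_char[OF K P N] unfolding q c by simp
  have "card ?K = k * (2 * k - 3)" using card_cyclic_sphere[OF n] by simp
  then have cK: "real (card ?K) = real k * (2 * real k - 3)" using k by simp
  have g: "2 * slicing_genus ?K V1 V2 = (real k - 1) * (real k - 2)"
    unfolding slicing_genus_def chi of_int_diff of_int_mult of_int_of_nat_eq cK
    by (simp add: field_simps)
  \<comment> \<open>\<open>choose_two\<close> uses division of natural numbers, which is exact only
    because one of two consecutive numbers is even.\<close>
  have "even ((k - 1) * (k - 1 - 1))" by (cases "k - 1") auto
  then have "2 * ((k - 1) choose 2) = (k - 1) * (k - 1 - 1)"
    unfolding choose_two by (rule dvd_mult_div_cancel)
  then have "2 * ((k - 1) choose 2) = (k - 1) * (k - 2)" by (simp add: numeral_2_eq_2)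
  then have "real (2 * ((k - 1) choose 2)) = real ((k - 1) * (k - 2))" by simp
  then have "2 * real ((k - 1) choose 2) = (real k - 1) * (real k - 2)"
    using k by (simp add: of_nat_diff)
  with g show "slicing_genus ?K V1 V2 = real ((k - 1) choose 2)" by simp
  have "4 * slicing_genus ?K V1 V2 = 2 * ((real k - 1) * (real k - 2))" using g by simp
  then show "real (slicing_quads ?K V1 V2) = 4 * slicing_genus ?K V1 V2 + 3 * real k - 4"
    unfolding q cK by (simp add: algebra_simps)
qed

theorem theorem4p2:
  shows "(\<forall>(K :: 'v set set) V1 V2 (c :: real).
            comb_3_manifold K \<and> two_neighborly K \<and> is_partition K V1 V2
            \<and> (\<exists>m::nat. c = real m / 2)
            \<and> real (card V1) + c = real (card V2) - c
          \<longrightarrow> real (slicing_quads K V1 V2)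
              \<ge> 4 * slicing_genus K V1 V2 + 3 * real (card (vertices K)) / 2 - (4 + 2 * c^2))
       \<and> (\<forall>k::nat. k \<ge> 3 \<longrightarrow>
           (\<exists>(K :: nat set set) V1 V2.
              comb_3_manifold K \<and> two_neighborly K \<and> card (vertices K) = 2 * k
              \<and> is_partition K V1 V2 \<and> card V1 = k \<and> card V2 = k
              \<and> slicing_genus K V1 V2 = real ((k - 1) choose 2)
              \<and> real (slicing_quads K V1 V2) = 4 * slicing_genus K V1 V2 + 3 * real k - 4))"
proof (intro conjI allI impI)
  fix K :: "'v set set" and V1 V2 and c :: real
  assume "comb_3_manifold K \<and> two_neighborly K \<and> is_partition K V1 V2
    \<and> (\<exists>m::nat. c = real m / 2) \<and> real (card V1) + c = real (card V2) - c"
  then show "real (slicing_quads K V1 V2)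
      \<ge> 4 * slicing_genus K V1 V2 + 3 * real (card (vertices K)) / 2 - (4 + 2 * c^2)"
    by (intro slicing_quads_lower_bound) auto
next
  fix k :: nat assume k: "k \<ge> 3"
  then have n: "5 \<le> 2 * k" by simp
  have "card (vertices (cyclic_sphere (2 * k))) = 2 * k"
    by (simp add: vertices_cyclic_sphere[OF n])
  then show "\<exists>(K :: nat set set) V1 V2.
      comb_3_manifold K \<and> two_neighborly K \<and> card (vertices K) = 2 * k
      \<and> is_partition K V1 V2 \<and> card V1 = k \<and> card V2 = k
      \<and> slicing_genus K V1 V2 = real ((k - 1) choose 2)
      \<and> real (slicing_quads K V1 V2) = 4 * slicing_genus K V1 V2 + 3 * real k - 4"
    using cyclic_sphere_manifold[OF n] cyclic_sphere_neighborly[OF n] cyclic_sphere_slicing[OF k]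
      card_parity_classes[of k]
    by (intro exI[of _ "cyclic_sphere (2 * k)"] exI[of _ "{i. i < 2 * k \<and> even i}"]
        exI[of _ "{i. i < 2 * k \<and> odd i}"] conjI) auto
qed

end
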